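(* Let the assumptions (D1)-(D4) recalled in the context hold, and let $K\in L_0$. Let $\beta\in(0,1)$, let $f$ belong to $\mathcal B^0_\beta(\Omega)$, and let $u\in H^1_0(\Omega)$ be the weak solution of $-\Delta u=f$ in $\Omega$, $u=0$ on $\partial\Omega$, which consequently (by the elliptic regularity recalled in the context) belongs to $\mathcal B^2_\beta(\Omega)$. Assume that $p_{K'}=2$ if $K'\in L_0$ and $p_{K'}\approx2$ if $K'\in L_1$. Then there exists $u_I\in V(K)$ such that $$|u-u_I|^2_{1,K}\lesssim\sigma^{2(1-\beta)n}\,\big\|\,|\mathbf x|^\beta|D^2u|\,\big\|^2_{0,K}+\|f-\Pi^0_{p_K-2}f\|^2_{0,K},$$ where $\sigma$ is the grading parameter of the mesh and $n+1$ is the number of layers.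
   Context: Notation. $\Omega\subset\mathbb R^2$ is an open simply connected polygonal domain and $\mathbf 0\in\partial\Omega$ is the only vertex at which $u$ can be singular. $\|\cdot\|_{\ell,D}$, $|\cdot|_{\ell,D}$ are the Sobolev norm and seminorm of $H^\ell(D)$; $\mathbb P_\ell(D)$ is the space of polynomials of degree at most $\ell$ on $D$. $a\lesssim b$ means $a\le c\,b$, and $a\approx b$ means $c_1a\le b\le c_2a$, with positive constants independent of the discretization parameters (number of layers $n$, mesh sizes, degrees of accuracy). Weighted spaces. With $\Phi_\beta(\mathbf x)=|\mathbf x|^\beta$, $|D^ku|^2=\sum_{|\boldsymbol\alpha|=k}|D^{\boldsymbol\alpha}u|^2$ and integers $m\ge\ell\ge0$, set $|u|^2_{H^{m,\ell}_\beta(D)}=\sum_{k=\ell}^m\|\,|D^ku|\,\Phi_{\beta+k-\ell}\|^2_{0,D}$; $H^{m,\ell}_\beta(D)$ is the set of $u\in L^2(D)$ with finite norm $\|u\|^2_{H^{m,\ell}_\beta(D)}=\|u\|^2_{\ell-1,D}+|u|^2_{H^{m,\ell}_\beta(D)}$ if $\ell\ge1$, and $\|u\|^2_{H^{m,0}_\beta(D)}=\sum_{k=0}^m\|\,|D^ku|\,\Phi_{\beta+k}\|^2_{0,D}$ if $\ell=0$. $\mathcal B^\ell_\beta(D)$ is the set of $u$ belonging to $H^{m,\ell}_\beta(D)$ for all $m\ge\ell$ with $\|\,|D^ku|\,\Phi_{\beta+k-\ell}\|_{0,D}\le c\,d^{k-\ell}(k-\ell)!$ for all $k\ge\ell$,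 with constants $c\ge0$, $d\ge1$ depending on $u$ and $D$. Known elliptic regularity (Babuška-Guo): if $f\in\mathcal B^0_\beta(\Omega)$ then $u\in\mathcal B^2_\beta(\Omega)$, where $\beta$ is such that $1-\frac{\pi}{\omega}<\beta<1$ if $\frac\pi\omega<1$, $\omega$ being the interior angle of $\Omega$ at $\mathbf 0$. Meshes. $\mathcal T_n$ is a conforming decomposition of $\Omega$ into polygons $K$; $h_K=\mathrm{diam}(K)$, $\mathcal E^K$ is the set of edges of $K$. $\mathcal T_n$ consists of $n+1$ layers: $L_0$ is the set of $K\in\mathcal T_n$ having $\mathbf 0$ as a vertex; for $j=1,\dots,n$, $L_j$ is the set of $K_1\in\mathcal T_n$ with $\overline{K_1}\cap\overline{K_2}\ne\emptyset$ for some $K_2\in L_{j-1}$ and $K_1\not\subseteq\bigcup_{i=0}^{j-1}L_i$. $\mathcal T_0=\{\Omega\}$ and $\mathcal T_{n+1}$ is obtained by refining $\mathcal T_n$ only in $L_0$. Let $\sigma\in(0,1)$ be the grading parameter. (D1) Every $K$ is star-shaped with respect to a ball of radius at least $\gamma h_K$, $\gamma>0$ independent of the decompositions. (D2) $|E|\ge\widetilde\gamma h_K$ for every $K$ and $E\in\mathcal E^K$, $\widetilde\gamma>0$ independent of the decompositions, and the number of edges of every $K$ is uniformly bounded. (D3) $h_K\approx\frac{1-\sigma}{\sigma}\mathrm{dist}(\mathbf 0,K)$ if $K\notin L_0$ and $h_K\approx\sigma^n$ if $K\in L_0$; the number of elements in each layer is uniformly bounded; $p_K\ge2$ for all $K$.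 (D4) Write $\mathcal T_n^0=L_0$, $\mathcal T_n^1=\bigcup_{j=1}^nL_j$. There is a collection $C_n^1$ of squares with $\mathrm{card}(C_n^1)=\mathrm{card}(\mathcal T_n^1)$ such that for each $K\in\mathcal T_n^1$ there is $Q(K)\in C_n^1$ with $Q(K)\supseteq K$, $h_K\approx h_{Q(K)}$, $\mathrm{dist}(\mathbf 0,Q(K))\approx h_K$; every $\mathbf x\in\Omega$ belongs to at most a fixed number of squares, independently of the discretization parameters; every $K\in\mathcal T_n^0$ is star-shaped with respect to $\mathbf 0$ and the subtriangulation of $K$ obtained by joining $\mathbf 0$ with the other vertices is uniformly shape regular. Virtual space. $p_K$ is the degree of accuracy of $K$. For an edge $E$, $p_E=\max\{p_{K_1},p_{K_2}\}$ if $E$ is shared by $K_1,K_2$, and $p_E=p_K$ if $E\subset\partial\Omega$ is an edge of $K$. $V(K)=\{v\in H^1(K):\Delta v\in\mathbb P_{p_K-2}(K),\ v|_{\partial K}\in\mathcal C^0(\partial K),\ v|_E\in\mathbb P_{p_E}(E)\ \forall E\in\mathcal E^K\}$. $\Pi^0_{p_K-2}$ is the $L^2(K)$-orthogonal projection onto $\mathbb P_{p_K-2}(K)$. *)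

theory Defs
  imports "HOL-Analysis.Analysis"
begin

section \<open>Sobolev spaces on open subsets of the plane\<close>

definition partial_deriv :: "2 \<Rightarrow> (real^2 \<Rightarrow> real) \<Rightarrow> real^2 \<Rightarrow> real" where
  "partial_deriv i f x = frechet_derivative f (at x) (axis i 1)"

definition smooth :: "(real^2 \<Rightarrow> real) \<Rightarrow> bool" where
  "smooth f \<longleftrightarrow> (\<forall>is. foldr partial_deriv is f differentiable_on UNIV)"

definition test_function :: "(real^2) set \<Rightarrow> (real^2 \<Rightarrow> real) \<Rightarrow> bool" where
  "test_function D \<phi> \<longleftrightarrow>
     smooth \<phi> \<and> compact (closure {x. \<phi> x \<noteq> 0}) \<and> closure {x. \<phi> x \<noteq> 0} \<subseteq> D"

text \<open>Multi-indices are pairs \<open>(a, b)\<close>. Two multi-indices that differ in the order of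
  differentiation are therefore counted once in \<open>|D\<^sup>k u|\<close>.\<close>

type_synonym multi_index = "nat \<times> nat"

definition order_of :: "multi_index \<Rightarrow> nat" where
  "order_of \<alpha> = fst \<alpha> + snd \<alpha>"

definition partials :: "multi_index \<Rightarrow> (real^2 \<Rightarrow> real) \<Rightarrow> real^2 \<Rightarrow> real" where
  "partials \<alpha> f = (partial_deriv 1 ^^ fst \<alpha>) ((partial_deriv 2 ^^ snd \<alpha>) f)"

definition locally_integrable :: "(real^2) set \<Rightarrow> (real^2 \<Rightarrow> real) \<Rightarrow> bool" where
  "locally_integrable D f \<longleftrightarrow> (\<forall>C. compact C \<and> C \<subseteq> D \<longrightarrow> f absolutely_integrable_on C)"

definition has_weak_deriv ::
  "(real^2) set \<Rightarrow> multi_index \<Rightarrow> (real^2 \<Rightarrow> real) \<Rightarrow> (real^2 \<Rightarrow> real) \<Rightarrow> bool" where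
  "has_weak_deriv D \<alpha> u g \<longleftrightarrow> locally_integrable D u \<and> locally_integrable D g \<and>
     (\<forall>\<phi>. test_function D \<phi> \<longrightarrow>
        (LINT x|lebesgue_on D. u x * partials \<alpha> \<phi> x) =
        (-1) ^ order_of \<alpha> * (LINT x|lebesgue_on D. g x * \<phi> x))"

text \<open>A representative of the weak derivative, which is unique up to null sets; it is only
  meaningful when the weak derivative exists.\<close>

definition weak_deriv ::
  "(real^2) set \<Rightarrow> multi_index \<Rightarrow> (real^2 \<Rightarrow> real) \<Rightarrow> real^2 \<Rightarrow> real" where
  "weak_deriv D \<alpha> u = (SOME g. has_weak_deriv D \<alpha> u g)"

definition square_integrable :: "'a::euclidean_space set \<Rightarrow> ('a \<Rightarrow> real) \<Rightarrow> bool" where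
  "square_integrable D f \<longleftrightarrow>
     f \<in> borel_measurable (lebesgue_on D) \<and> integrable (lebesgue_on D) (\<lambda>x. (f x)\<^sup>2)"

definition l2_norm :: "'a::euclidean_space set \<Rightarrow> ('a \<Rightarrow> real) \<Rightarrow> real" where
  "l2_norm D f = sqrt (LINT x|lebesgue_on D. (f x)\<^sup>2)"

definition sobolev_space :: "nat \<Rightarrow> (real^2) set \<Rightarrow> (real^2 \<Rightarrow> real) set" where
  "sobolev_space l D = {u. square_integrable D u \<and>
     (\<forall>\<alpha>. order_of \<alpha> \<le> l \<longrightarrow> (\<exists>g. has_weak_deriv D \<alpha> u g \<and> square_integrable D g))}"

definition sobolev_norm :: "nat \<Rightarrow> (real^2) set \<Rightarrow> (real^2 \<Rightarrow> real) \<Rightarrow> real" where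
  "sobolev_norm l D u = sqrt (\<Sum>\<alpha> | order_of \<alpha> \<le> l. (l2_norm D (weak_deriv D \<alpha> u))\<^sup>2)"

definition sobolev_seminorm :: "nat \<Rightarrow> (real^2) set \<Rightarrow> (real^2 \<Rightarrow> real) \<Rightarrow> real" where
  "sobolev_seminorm l D u = sqrt (\<Sum>\<alpha> | order_of \<alpha> = l. (l2_norm D (weak_deriv D \<alpha> u))\<^sup>2)"

definition H1_0 :: "(real^2) set \<Rightarrow> (real^2 \<Rightarrow> real) set" where
  "H1_0 D = {u \<in> sobolev_space 1 D.
     \<forall>\<epsilon>>0. \<exists>\<phi>. test_function D \<phi> \<and> sobolev_norm 1 D (\<lambda>x. u x - \<phi> x) < \<epsilon>}"

definition weak_solution :: "(real^2) set \<Rightarrow> (real^2 \<Rightarrow> real) \<Rightarrow> (real^2 \<Rightarrow> real) \<Rightarrow> bool" where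
  "weak_solution D f u \<longleftrightarrow> u \<in> H1_0 D \<and>
     (\<forall>v\<in>H1_0 D. (LINT x|lebesgue_on D.
          (\<Sum>\<alpha> | order_of \<alpha> = 1. weak_deriv D \<alpha> u x * weak_deriv D \<alpha> v x)) =
        (LINT x|lebesgue_on D. f x * v x))"

definition has_weak_laplacian ::
  "(real^2) set \<Rightarrow> (real^2 \<Rightarrow> real) \<Rightarrow> (real^2 \<Rightarrow> real) \<Rightarrow> bool" where
  "has_weak_laplacian D v g \<longleftrightarrow> locally_integrable D v \<and> locally_integrable D g \<and>
     (\<forall>\<phi>. test_function D \<phi> \<longrightarrow>
        (LINT x|lebesgue_on D. v x * (partials (2, 0) \<phi> x + partials (0, 2) \<phi> x)) =
        (LINT x|lebesgue_on D. g x * \<phi> x))"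


section \<open>Weighted spaces\<close>

definition abs_deriv :: "(real^2) set \<Rightarrow> nat \<Rightarrow> (real^2 \<Rightarrow> real) \<Rightarrow> real^2 \<Rightarrow> real" where
  "abs_deriv D k u x = sqrt (\<Sum>\<alpha> | order_of \<alpha> = k. (weak_deriv D \<alpha> u x)\<^sup>2)"

definition weighted_deriv ::
  "(real^2) set \<Rightarrow> real \<Rightarrow> nat \<Rightarrow> (real^2 \<Rightarrow> real) \<Rightarrow> real^2 \<Rightarrow> real" where
  "weighted_deriv D s k u x = abs_deriv D k u x * norm x powr s"

text \<open>Membership says that every summand of the defining norm is finite. The condition
  \<open>u \<in> H\<^sup>l\<^sup>-\<^sup>1(D)\<close> only occurs for \<open>l \<ge> 1\<close>.\<close>

definition weighted_space ::
  "real \<Rightarrow> nat \<Rightarrow> nat \<Rightarrow> (real^2) set \<Rightarrow> (real^2 \<Rightarrow> real) set" where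
  "weighted_space \<beta> m l D = {u. square_integrable D u \<and>
     (l \<ge> 1 \<longrightarrow> u \<in> sobolev_space (l - 1) D) \<and>
     (\<forall>\<alpha>. order_of \<alpha> \<le> m \<longrightarrow> (\<exists>g. has_weak_deriv D \<alpha> u g)) \<and>
     (\<forall>k\<in>{l..m}. square_integrable D (weighted_deriv D (\<beta> + real (k - l)) k u))}"

definition analytic_weighted_space ::
  "real \<Rightarrow> nat \<Rightarrow> (real^2) set \<Rightarrow> (real^2 \<Rightarrow> real) set" where
  "analytic_weighted_space \<beta> l D = {u. (\<forall>m\<ge>l. u \<in> weighted_space \<beta> m l D) \<and>
     (\<exists>c\<ge>0. \<exists>d\<ge>1. \<forall>k\<ge>l.
        l2_norm D (weighted_deriv D (\<beta> + real (k - l)) k u) \<le> c * d ^ (k - l) * fact (k - l))}"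


section \<open>Polynomials\<close>

definition polynomials :: "nat \<Rightarrow> (real^2 \<Rightarrow> real) set" where
  "polynomials l = {q. \<exists>c::multi_index \<Rightarrow> real. \<forall>x.
     q x = (\<Sum>\<alpha> | order_of \<alpha> \<le> l. c \<alpha> * (x $ 1) ^ fst \<alpha> * (x $ 2) ^ snd \<alpha>)}"

definition l2_projection :: "(real^2) set \<Rightarrow> nat \<Rightarrow> (real^2 \<Rightarrow> real) \<Rightarrow> real^2 \<Rightarrow> real" where
  "l2_projection D l f = (THE q. q \<in> polynomials l \<and>
     (\<forall>r\<in>polynomials l. (LINT x|lebesgue_on D. (f x - q x) * r x) = 0))"


section \<open>Polygons\<close>

text \<open>A polygon is given by the cyclic list of its vertices, and its \<open>region\<close> is the open set that
  it bounds. Straight angles are allowed: hanging nodes count as vertices, so the region alone does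
  not determine the edges.\<close>

type_synonym polygon = "(real^2) list"

fun polypath :: "(real^2) list \<Rightarrow> real \<Rightarrow> real^2" where
  "polypath [] = linepath 0 0"
| "polypath [v] = linepath v v"
| "polypath [v, w] = linepath v w"
| "polypath (v # w # x # vs) = linepath v w +++ polypath (w # x # vs)"

definition boundary_path :: "polygon \<Rightarrow> real \<Rightarrow> real^2" where
  "boundary_path K = polypath (K @ [hd K])"

definition is_polygon :: "polygon \<Rightarrow> bool" where
  "is_polygon K \<longleftrightarrow> length K \<ge> 3 \<and> simple_path (boundary_path K)"

definition region :: "polygon \<Rightarrow> (real^2) set" where
  "region K = inside (path_image (boundary_path K))"

definition sides :: "polygon \<Rightarrow> ((real^2) \<times> (real^2)) set" where
  "sides K = set (zip K (rotate1 K))"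

definition edges :: "polygon \<Rightarrow> (real^2) set set" where
  "edges K = (\<lambda>(a, b). closed_segment a b) ` sides K"

definition star_shaped_wrt :: "(real^2) set \<Rightarrow> (real^2) set \<Rightarrow> bool" where
  "star_shaped_wrt S A \<longleftrightarrow> (\<forall>a\<in>A. \<forall>x\<in>S. closed_segment a x \<subseteq> S)"

definition is_square :: "(real^2) set \<Rightarrow> bool" where
  "is_square Q \<longleftrightarrow> (\<exists>a v w. v \<bullet> w = 0 \<and> norm v = norm w \<and> v \<noteq> 0 \<and>
     Q = {a + s *\<^sub>R v + t *\<^sub>R w | s t. s \<in> {0..1} \<and> t \<in> {0..1}})"


section \<open>Meshes\<close>

text \<open>In a conforming mesh two edges of different elements coincide or meet in common vertices.\<close>

definition conforming_decomposition :: "(real^2) set \<Rightarrow> polygon set \<Rightarrow> bool" where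
  "conforming_decomposition \<Omega> T \<longleftrightarrow> finite T \<and>
     (\<forall>K\<in>T. is_polygon K \<and> region K \<subseteq> \<Omega>) \<and>
     closure \<Omega> = (\<Union>K\<in>T. closure (region K)) \<and>
     (\<forall>K1\<in>T. \<forall>K2\<in>T. K1 \<noteq> K2 \<longrightarrow> region K1 \<inter> region K2 = {} \<and>
        (\<forall>E1\<in>edges K1. \<forall>E2\<in>edges K2. E1 = E2 \<or> E1 \<inter> E2 \<subseteq> set K1 \<inter> set K2))"

fun layer :: "polygon set \<Rightarrow> nat \<Rightarrow> polygon set" where
  "layer T 0 = {K \<in> T. 0 \<in> set K}"
| "layer T (Suc j) = {K1 \<in> T.
     (\<exists>K2\<in>layer T j. closure (region K1) \<inter> closure (region K2) \<noteq> {}) \<and>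
     \<not> region K1 \<subseteq> (\<Union>i\<in>{0..j}. \<Union>K\<in>layer T i. region K)}"

text \<open>Elements outside layer 0 keep their region under refinement, but may acquire hanging nodes
  created on edges shared with layer 0.\<close>

definition refines_in_layer_0 :: "polygon set \<Rightarrow> polygon set \<Rightarrow> bool" where
  "refines_in_layer_0 T T' \<longleftrightarrow>
     (\<forall>K \<in> T - layer T 0. \<exists>K'\<in>T'. region K' = region K \<and> set K \<subseteq> set K') \<and>
     (\<forall>K'\<in>T'. (\<exists>K \<in> T - layer T 0. region K' = region K) \<or>
        (\<exists>K\<in>layer T 0. region K' \<subseteq> region K))"

definition layered_meshes :: "polygon \<Rightarrow> (nat \<Rightarrow> polygon set) \<Rightarrow> bool" where
  "layered_meshes P T \<longleftrightarrow> T 0 = {P} \<and>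
     (\<forall>n. conforming_decomposition (region P) (T n) \<and>
        T n = (\<Union>j\<in>{0..n}. layer (T n) j) \<and> (\<forall>j\<le>n. layer (T n) j \<noteq> {}) \<and>
        refines_in_layer_0 (T n) (T (Suc n)))"

text \<open>\<open>equiv_up_to c1 c2 a b\<close> is the relation \<open>a \<approx> b\<close> with explicit constants. Since constants can be
  decreased resp. increased, a single pair \<open>c1\<close>, \<open>c2\<close> and a single bound \<open>N\<close> on cardinalities serve
  all of the mesh assumptions.\<close>

definition equiv_up_to :: "real \<Rightarrow> real \<Rightarrow> real \<Rightarrow> real \<Rightarrow> bool" where
  "equiv_up_to c1 c2 a b \<longleftrightarrow> c1 * a \<le> b \<and> b \<le> c2 * a"

definition D1 :: "real \<Rightarrow> (nat \<Rightarrow> polygon set) \<Rightarrow> bool" where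
  "D1 \<gamma> T \<longleftrightarrow> (\<forall>n. \<forall>K\<in>T n. \<exists>z r. r \<ge> \<gamma> * diameter (region K) \<and>
     ball z r \<subseteq> region K \<and> star_shaped_wrt (region K) (ball z r))"

definition D2 :: "real \<Rightarrow> nat \<Rightarrow> (nat \<Rightarrow> polygon set) \<Rightarrow> bool" where
  "D2 \<gamma>' N T \<longleftrightarrow> (\<forall>n. \<forall>K\<in>T n. card (edges K) \<le> N \<and>
     (\<forall>E\<in>edges K. diameter E \<ge> \<gamma>' * diameter (region K)))"

definition D3 ::
  "real \<Rightarrow> real \<Rightarrow> real \<Rightarrow> nat \<Rightarrow> (nat \<Rightarrow> polygon set) \<Rightarrow> (nat \<Rightarrow> polygon \<Rightarrow> nat) \<Rightarrow> bool" where
  "D3 \<sigma> c1 c2 N T p \<longleftrightarrow> (\<forall>n.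
     (\<forall>K \<in> T n - layer (T n) 0.
        equiv_up_to c1 c2 (diameter (region K)) ((1 - \<sigma>) / \<sigma> * infdist 0 (region K))) \<and>
     (\<forall>K \<in> layer (T n) 0. equiv_up_to c1 c2 (diameter (region K)) (\<sigma> ^ n)) \<and>
     (\<forall>j\<le>n. card (layer (T n) j) \<le> N) \<and>
     (\<forall>K\<in>T n. p n K \<ge> 2))"

text \<open>The triangles obtained by joining the origin with the other vertices of an element of layer 0
  are the convex hulls of the origin and an edge not containing it.\<close>

definition D4 :: "real \<Rightarrow> real \<Rightarrow> nat \<Rightarrow> real \<Rightarrow> (real^2) set \<Rightarrow> (nat \<Rightarrow> polygon set) \<Rightarrow> bool" where
  "D4 c1 c2 N \<kappa> \<Omega> T \<longleftrightarrow> (\<forall>n.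
     (\<exists>C. finite C \<and> (\<forall>Q\<in>C. is_square Q) \<and>
        card C = card (\<Union>j\<in>{1..n}. layer (T n) j) \<and>
        (\<forall>K \<in> (\<Union>j\<in>{1..n}. layer (T n) j). \<exists>Q\<in>C. region K \<subseteq> Q \<and>
           equiv_up_to c1 c2 (diameter (region K)) (diameter Q) \<and>
           equiv_up_to c1 c2 (infdist 0 Q) (diameter (region K))) \<and>
        (\<forall>x\<in>\<Omega>. card {Q \<in> C. x \<in> Q} \<le> N)) \<and>
     (\<forall>K \<in> layer (T n) 0. star_shaped_wrt (closure (region K)) {0} \<and>
        (\<forall>E\<in>edges K. 0 \<notin> E \<longrightarrow>
           (\<exists>z. ball z (\<kappa> * diameter (convex hull (insert 0 E))) \<subseteq> convex hull (insert 0 E)))))"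


section \<open>The local virtual element space\<close>

text \<open>\<open>w\<close> is the trace of \<open>v\<close> on the boundary of \<open>K\<close>: the limit in \<open>L\<^sup>2\<close> of every edge of the
  boundary values of smooth functions that converge to \<open>v\<close> in \<open>H\<^sup>1(K)\<close>. Edges are parametrized over
  the unit interval; this changes the \<open>L\<^sup>2\<close>-norm on an edge by a constant factor.\<close>

definition has_trace :: "polygon \<Rightarrow> (real^2 \<Rightarrow> real) \<Rightarrow> (real^2 \<Rightarrow> real) \<Rightarrow> bool" where
  "has_trace K v w \<longleftrightarrow>
     (\<forall>(a, b)\<in>sides K. square_integrable {0..1} (\<lambda>t. w (linepath a b t))) \<and>
     (\<exists>\<Phi>::nat \<Rightarrow> real^2 \<Rightarrow> real. (\<forall>j. smooth (\<Phi> j)) \<and>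
        (\<lambda>j. sobolev_norm 1 (region K) (\<lambda>x. \<Phi> j x - v x)) \<longlonglongrightarrow> 0 \<and>
        (\<forall>(a, b)\<in>sides K.
           (\<lambda>j. l2_norm {0..1} (\<lambda>t. \<Phi> j (linepath a b t) - w (linepath a b t))) \<longlonglongrightarrow> 0))"

text \<open>The maximum ranges over the two elements sharing an interior edge, and over the single
  element having a given boundary edge.\<close>

definition edge_degree :: "polygon set \<Rightarrow> (polygon \<Rightarrow> nat) \<Rightarrow> (real^2) set \<Rightarrow> nat" where
  "edge_degree T p E = Max (p ` {K \<in> T. E \<in> edges K})"

definition virtual_space ::
  "polygon set \<Rightarrow> (polygon \<Rightarrow> nat) \<Rightarrow> polygon \<Rightarrow> (real^2 \<Rightarrow> real) set" where
  "virtual_space T p K = {v \<in> sobolev_space 1 (region K).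
     (\<exists>q\<in>polynomials (p K - 2). has_weak_laplacian (region K) v q) \<and>
     (\<exists>w. has_trace K v w \<and> continuous_on (frontier (region K)) w \<and>
        (\<forall>E\<in>edges K. \<exists>q\<in>polynomials (edge_degree T p E). \<forall>x\<in>E. w x = q x))}"

end

theory Submission
  imports Defs
begin

text \<open>
  The approximation \<open>u\<^sub>I\<close> can be chosen linear. A linear function is harmonic and restricts to a
  polynomial of degree at most one on every edge, so it lies in the virtual element space of every
  element whose degree is at least one (\<open>linear_form_virtual_space\<close>). Subtracting
  \<open>a x\<^sub>1 + b x\<^sub>2\<close> from \<open>u\<close> subtracts the constants \<open>a\<close> and \<open>b\<close> from the two first derivatives of \<open>u\<close>.
  It therefore suffices to approximate each first derivative \<open>g\<close> by a constant in \<open>L\<^sup>2(K)\<close>, with an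
  error controlled by the weighted norm of \<open>\<nabla>g\<close>, that is, of \<open>D\<^sup>2u\<close>.

  This is a weighted Poincare inequality (\<open>weighted_poincare\<close>) on an open set \<open>K\<close> of diameter \<open>h\<close>
  that is star-shaped with respect to a ball of centre \<open>z\<close> and radius \<open>r\<close> and does not contain the
  origin. Take \<open>y\<close> in the concentric ball \<open>B\<close> of radius \<open>r / 2\<close>, take \<open>x\<close> in \<open>K\<close>, and write
  \<open>p\<^sub>t = (1 - t) y + t x\<close>. Then \<open>g x - g y\<close> is the integral of \<open>\<nabla>g(p\<^sub>t) \<bullet> (x - y)\<close> over \<open>t\<close> in
  \<open>[0, 1]\<close>. The segment stays away from the origin: if \<open>|p\<^sub>t|\<close> were smaller than \<open>(1 - t) r / 2\<close>, then
  moving \<open>y\<close> by less than \<open>r / 2\<close> would give a segment from the large ball to \<open>x\<close> through the origin,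
  which would put the origin into \<open>K\<close>. Hence \<open>|p\<^sub>t|\<^sup>-\<^sup>\<beta>\<close> is at most a multiple of
  \<open>r\<^sup>-\<^sup>\<beta> (1 - t)\<^sup>-\<^sup>\<beta>\<close>, and this is integrable in \<open>t\<close> because \<open>\<beta> < 1\<close>. The inequality of Cauchy and
  Schwarz bounds \<open>|g x - g y|\<^sup>2\<close> by an integral over \<open>t\<close> of
  \<open>(1 - t)\<^sup>-\<^sup>\<beta> |p\<^sub>t|\<^sup>2\<^sup>\<beta> |\<nabla>g(p\<^sub>t)|\<^sup>2\<close>. Integrating over \<open>x\<close> and \<open>y\<close> and substituting \<open>p\<^sub>t\<close> for \<open>y\<close>
  if \<open>t \<le> 1/2\<close> and for \<open>x\<close> if \<open>t \<ge> 1/2\<close>, with a Jacobian of at least \<open>1/4\<close>, bounds the double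
  integral of \<open>|g x - g y|\<^sup>2\<close>. Some \<open>y\<close> does no worse than the average over \<open>B\<close>, and \<open>g y\<close> is the
  constant. With \<open>r = \<gamma> h\<close> the bound is a multiple of \<open>h\<^sup>2\<^sup>-\<^sup>2\<^sup>\<beta>\<close>, and in the layer at the origin
  \<open>h\<close> is at most \<open>\<sigma>\<^sup>n / c\<^sub>1\<close>.

  The derivatives are weak ones, so the formula for \<open>g x - g y\<close> has to be derived by testing. For a
  fixed vector \<open>v\<close>, Fubini's theorem and translation invariance turn the definition of the weak
  gradient into an identity between the integrals of \<open>g (x + v) - g x\<close> and of
  \<open>\<integral>\<^sub>0\<^sup>1 \<nabla>g(x + t v) \<bullet> v dt\<close> against any test function, and the fundamental lemma of the
  calculus of variations makes it an identity for almost every \<open>x\<close> (\<open>weak_gradient_translate\<close>).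
  The fundamental lemma also shows that weak derivatives are unique up to null sets, which allows
  the chosen representatives to be computed.
\<close>

section \<open>A class of explicit smooth functions\<close>

text \<open>The functions \<open>t\<^sup>-\<^sup>m exp (-1/t)\<close>, extended by zero: a family that contains the standard smooth
  cutoff and whose derivatives are linear combinations of members of the family.\<close>

definition flat_exp :: "nat \<Rightarrow> real \<Rightarrow> real" where
  "flat_exp m t = (if t > 0 then inverse t ^ m * exp (- inverse t) else 0)"

lemma flat_exp_over_t_tendsto_0: "((\<lambda>t. flat_exp m t / t) \<longlongrightarrow> 0) (at 0)"
proof -
  have "((\<lambda>t::real. inverse t ^ Suc m / exp (inverse t)) \<longlongrightarrow> 0) (at_right 0)"
    using filterlim_compose[OF tendsto_power_div_exp_0 filterlim_inverse_at_top_right, of "Suc m"] .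
  then have "((\<lambda>t. flat_exp m t / t) \<longlongrightarrow> 0) (at_right 0)"
    by (rule Lim_transform_eventually)
       (auto simp: flat_exp_def eventually_at_filter field_simps exp_minus power_inverse)
  moreover have "((\<lambda>t. flat_exp m t / t) \<longlongrightarrow> 0) (at_left 0)"
    by (rule Lim_transform_eventually[of "\<lambda>_. 0"]) (auto simp: flat_exp_def eventually_at_filter)
  ultimately show ?thesis
    by (simp add: filterlim_split_at)
qed

lemma flat_exp_has_derivative:
  "(flat_exp m has_real_derivative flat_exp (m + 2) t - real m * flat_exp (m + 1) t) (at t)"
proof (cases t "0::real" rule: linorder_cases)
  case less
  have "((\<lambda>_. 0) has_real_derivative 0) (at t)"
    by simp
  then have "(flat_exp m has_real_derivative 0) (at t)"
    by (rule has_field_derivative_transform_within_open[where S = "{..<0}"])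
       (use less in \<open>auto simp: flat_exp_def\<close>)
  with less show ?thesis
    by (simp add: flat_exp_def)
next
  case equal
  have "(flat_exp m has_real_derivative 0) (at 0)"
    using flat_exp_over_t_tendsto_0[of m] by (simp add: has_field_derivative_iff flat_exp_def)
  with equal show ?thesis
    by (simp add: flat_exp_def)
next
  case greater
  have *: "(inverse has_real_derivative - (inverse t ^ 2)) (at t)"
    using DERIV_inverse[of t] greater by (simp add: numeral_2_eq_2)
  have "((\<lambda>t. exp (- inverse t)) has_real_derivative exp (- inverse t) * - (- (inverse t ^ 2))) (at t)"
    by (intro DERIV_fun_exp DERIV_minus *)
  from DERIV_mult[OF DERIV_power[OF *, of m] this]
  have "((\<lambda>t. inverse t ^ m * exp (- inverse t)) has_real_derivative
      inverse t ^ (m + 2) * exp (- inverse t) - real m * (inverse t ^ (m + 1) * exp (- inverse t))) (at t)"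
    by (rule DERIV_cong) (cases m; simp add: power2_eq_square algebra_simps)
  then have "(flat_exp m has_real_derivative
      inverse t ^ (m + 2) * exp (- inverse t) - real m * (inverse t ^ (m + 1) * exp (- inverse t))) (at t)"
    by (rule has_field_derivative_transform_within_open[where S = "{0<..}"])
       (use greater in \<open>auto simp: flat_exp_def\<close>)
  with greater show ?thesis
    by (simp add: flat_exp_def)
qed

text \<open>A concrete algebra of smooth functions that is closed under partial derivatives and translations
  and rich enough to contain smooth approximations of the indicators of boxes. Statements about all
  its members follow by induction; in particular mixed partial derivatives commute.\<close>

inductive_set cutoff_algebra :: "(real^2 \<Rightarrow> real) set" where
  const: "(\<lambda>x. c) \<in> cutoff_algebra"
| coord: "(\<lambda>x. x $ i) \<in> cutoff_algebra"
| cutoff: "(\<lambda>x. flat_exp m (k * x $ i + s)) \<in> cutoff_algebra"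
| add: "f \<in> cutoff_algebra \<Longrightarrow> g \<in> cutoff_algebra \<Longrightarrow> (\<lambda>x. f x + g x) \<in> cutoff_algebra"
| mult: "f \<in> cutoff_algebra \<Longrightarrow> g \<in> cutoff_algebra \<Longrightarrow> (\<lambda>x. f x * g x) \<in> cutoff_algebra"

lemma partial_deriv_eqI:
  assumes "\<And>x. (f has_derivative f' x) (at x)"
  shows "partial_deriv i f = (\<lambda>x. f' x (axis i 1))"
  by (simp add: partial_deriv_def fun_eq_iff frechet_derivative_at[OF assms, symmetric])

lemma partial_deriv_const: "partial_deriv i (\<lambda>x. c) = (\<lambda>x. 0)"
  by (rule partial_deriv_eqI) (rule has_derivative_const)

lemma partial_deriv_coord: "partial_deriv i (\<lambda>x. x $ j) = (\<lambda>x. if i = j then 1 else 0)"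
proof -
  have "partial_deriv i (\<lambda>x. x $ j) = (\<lambda>x. (axis i 1 :: real^2) $ j)"
    by (rule partial_deriv_eqI) (rule bounded_linear.has_derivative[OF bounded_linear_vec_nth has_derivative_ident])
  then show ?thesis
    by (auto simp: axis_def)
qed

lemma has_derivative_cutoff:
  "((\<lambda>x::real^2. flat_exp m (k * x $ j + s)) has_derivative
    (\<lambda>v. (flat_exp (m + 2) (k * x $ j + s) - real m * flat_exp (m + 1) (k * x $ j + s)) * (k * v $ j))) (at x)"
proof -
  have "((\<lambda>x::real^2. k * x $ j + s) has_derivative (\<lambda>v. k * v $ j)) (at x)"
    by (auto intro!: derivative_eq_intros bounded_linear.has_derivative[OF bounded_linear_vec_nth])
  from has_derivative_compose[OF this, of "flat_exp m"] flat_exp_has_derivative show ?thesis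
    unfolding has_field_derivative_def by blast
qed

lemma partial_deriv_cutoff:
  "partial_deriv i (\<lambda>x. flat_exp m (k * x $ j + s)) =
   (\<lambda>x. (if i = j then k else 0) *
     (flat_exp (m + 2) (k * x $ j + s) + (- real m) * flat_exp (m + 1) (k * x $ j + s)))"
  by (subst partial_deriv_eqI[OF has_derivative_cutoff]) (auto simp: axis_def)

lemma has_derivative_frechet:
  assumes "f differentiable_on UNIV"
  shows "(f has_derivative frechet_derivative f (at x)) (at x)"
  using assms by (simp add: differentiable_on_def frechet_derivative_works[symmetric])

lemma partial_deriv_add:
  assumes "f differentiable_on UNIV" "g differentiable_on UNIV"
  shows "partial_deriv i (\<lambda>x. f x + g x) = (\<lambda>x. partial_deriv i f x + partial_deriv i g x)"
  using partial_deriv_eqI[OF has_derivative_add[OF assms[THEN has_derivative_frechet]]]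
  by (simp add: partial_deriv_def)

lemma partial_deriv_mult:
  assumes "f differentiable_on UNIV" "g differentiable_on UNIV"
  shows "partial_deriv i (\<lambda>x. f x * g x) = (\<lambda>x. f x * partial_deriv i g x + partial_deriv i f x * g x)"
  using partial_deriv_eqI[OF has_derivative_mult[OF assms[THEN has_derivative_frechet]]]
  by (simp add: partial_deriv_def)

text \<open>By the rules for sums and products, both conclusions pass from the generators to the algebra.
  Together they give smoothness by iteration.\<close>

lemma cutoff_algebra_partial_deriv:
  assumes "f \<in> cutoff_algebra"
  shows "f differentiable_on UNIV \<and> (\<forall>i. partial_deriv i f \<in> cutoff_algebra)"
  using assms
proof induction
  case (coord j)
  then show ?case
    by (auto simp: partial_deriv_coord differentiable_on_def cutoff_algebra.const
        intro!: bounded_linear_imp_differentiable bounded_linear_vec_nth)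
next
  case (cutoff m k j s)
  have "(\<lambda>x. flat_exp m (k * x $ j + s)) differentiable_on UNIV"
    using has_derivative_cutoff[of m k j s] unfolding differentiable_on_def differentiable_def by blast
  then show ?case
    unfolding partial_deriv_cutoff by (intro conjI allI cutoff_algebra.intros)
next
  case (add f g)
  then show ?case
    by (auto simp: partial_deriv_add intro!: cutoff_algebra.add)
next
  case (mult f g)
  then show ?case
    by (auto simp: partial_deriv_mult intro!: cutoff_algebra.intros)
qed (auto simp: partial_deriv_const cutoff_algebra.const)

lemma cutoff_algebra_smooth:
  assumes "f \<in> cutoff_algebra"
  shows "smooth f"
proof -
  have "foldr partial_deriv is f \<in> cutoff_algebra" for "is"
    using assms by (induction "is") (auto dest: cutoff_algebra_partial_deriv)
  then show ?thesis
    by (auto simp: smooth_def dest: cutoff_algebra_partial_deriv)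
qed

lemma cutoff_algebra_partial_deriv_commute:
  assumes "f \<in> cutoff_algebra"
  shows "partial_deriv i (partial_deriv j f) = partial_deriv j (partial_deriv i f)"
  using assms
proof induction
  case (const c)
  then show ?case by (simp add: partial_deriv_const)
next
  case (coord l)
  then show ?case by (simp add: partial_deriv_coord partial_deriv_const)
next
  case (cutoff m k l s)
  have *: "(\<lambda>x. flat_exp (m + 2) (k * x $ l + s) + (- real m) * flat_exp (m + 1) (k * x $ l + s))
      \<in> cutoff_algebra" (is "?g \<in> _")
    by (intro cutoff_algebra.intros)
  have "partial_deriv i (partial_deriv j (\<lambda>x. flat_exp m (k * x $ l + s))) =
     (\<lambda>x. (if j = l then k else 0) * partial_deriv i ?g x)" for i j
    unfolding partial_deriv_cutoff
    by (subst partial_deriv_mult)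
       (use cutoff_algebra_partial_deriv[OF *] in \<open>auto simp: partial_deriv_const\<close>)
  moreover have "partial_deriv i ?g = (\<lambda>x. 0)" if "i \<noteq> l" for i
    using that
    by (subst partial_deriv_add, (intro conjunct1[OF cutoff_algebra_partial_deriv] cutoff_algebra.intros)+,
        subst partial_deriv_mult, (intro conjunct1[OF cutoff_algebra_partial_deriv] cutoff_algebra.intros)+)
       (simp add: partial_deriv_cutoff partial_deriv_const)
  ultimately show ?case
    by (auto simp: fun_eq_iff)
next
  case (add f g)
  then show ?case
    using cutoff_algebra_partial_deriv by (simp add: partial_deriv_add)
next
  case (mult f g)
  note d = cutoff_algebra_partial_deriv[THEN conjunct1]
  have dm: "f \<in> cutoff_algebra \<Longrightarrow> g \<in> cutoff_algebra \<Longrightarrow> (\<lambda>x. f x * g x) differentiable_on UNIV" for f g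
    by (intro d cutoff_algebra.intros)
  show ?case
    using mult cutoff_algebra_partial_deriv
    by (simp add: partial_deriv_mult partial_deriv_add d dm algebra_simps)
qed

lemma cutoff_algebra_translate:
  assumes "f \<in> cutoff_algebra"
  shows "(\<lambda>x. f (x - v)) \<in> cutoff_algebra"
  using assms
proof induction
  case (coord i)
  then show ?case
    using cutoff_algebra.add[OF cutoff_algebra.coord[of i] cutoff_algebra.const[of "- v $ i"]] by simp
next
  case (cutoff m k i s)
  have "(\<lambda>x. flat_exp m (k * (x - v) $ i + s)) = (\<lambda>x. flat_exp m (k * x $ i + (s - k * v $ i)))"
    by (simp add: algebra_simps)
  then show ?case
    by (simp only: cutoff_algebra.cutoff)
qed (auto intro: cutoff_algebra.intros)

lemma partial_deriv_translate:
  assumes "f differentiable_on UNIV"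
  shows "partial_deriv i (\<lambda>x. f (x - v)) = (\<lambda>x. partial_deriv i f (x - v))"
proof -
  have "((\<lambda>x. f (x - v)) has_derivative frechet_derivative f (at (x - v))) (at x)" for x
  proof -
    have "((\<lambda>x. x - v) has_derivative (\<lambda>y. y)) (at x)"
      by (auto intro!: derivative_eq_intros)
    moreover have "(f has_derivative frechet_derivative f (at (x - v))) (at (x - v))"
      by (rule has_derivative_frechet[OF assms])
    ultimately show ?thesis
      using has_derivative_compose[of "\<lambda>x. x - v" "\<lambda>y. y" x UNIV f] by simp
  qed
  from partial_deriv_eqI[OF this] show ?thesis
    by (simp add: partial_deriv_def)
qed

section \<open>Smooth functions and test functions\<close>

lemma frechet_derivative_real2:
  fixes f :: "real^2 \<Rightarrow> real"
  assumes "f differentiable_on UNIV"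
  shows "frechet_derivative f (at x) v = v $ 1 * partial_deriv 1 f x + v $ 2 * partial_deriv 2 f x"
proof -
  interpret f': linear "frechet_derivative f (at x)"
    using assms by (intro linear_frechet_derivative) (simp add: differentiable_on_def)
  have "v = v $ 1 *\<^sub>R axis 1 1 + v $ 2 *\<^sub>R axis 2 1"
    by (simp add: vec_eq_iff axis_def forall_2)
  then have "frechet_derivative f (at x) v = frechet_derivative f (at x) (v $ 1 *\<^sub>R axis 1 1 + v $ 2 *\<^sub>R axis 2 1)"
    by simp
  also have "\<dots> = v $ 1 * partial_deriv 1 f x + v $ 2 * partial_deriv 2 f x"
    unfolding partial_deriv_def f'.add f'.scale by simp
  finally show ?thesis .
qed

lemma smooth_differentiable: "smooth f \<Longrightarrow> f differentiable_on UNIV"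
  unfolding smooth_def by (drule spec[where x = "[]"]) simp

lemma smooth_partial_deriv:
  assumes "smooth f"
  shows "smooth (partial_deriv i f)"
  unfolding smooth_def
proof
  fix "is"
  show "foldr partial_deriv is (partial_deriv i f) differentiable_on UNIV"
    using assms unfolding smooth_def by (drule_tac spec[where x = "is @ [i]"]) simp
qed

lemma smooth_continuous: "smooth f \<Longrightarrow> continuous_on S f"
  by (meson continuous_on_subset differentiable_imp_continuous_on smooth_differentiable subset_UNIV)

lemma partial_deriv_zero_on_open:
  assumes "open S" "x \<in> S" "\<And>y. y \<in> S \<Longrightarrow> f y = 0"
  shows "partial_deriv i f x = 0"
proof -
  have "((\<lambda>_. 0) has_derivative (\<lambda>_. 0)) (at x)"
    by simp
  then have "(f has_derivative (\<lambda>_. 0)) (at x)"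
    by (rule has_derivative_transform_within_open[OF _ assms(1,2)]) (simp add: assms(3))
  then show ?thesis
    by (simp add: partial_deriv_def frechet_derivative_at[symmetric])
qed

lemma zero_off_closed_support: "x \<notin> closure {x. f x \<noteq> 0} \<Longrightarrow> f x = 0"
  using closure_subset[of "{x. f x \<noteq> 0}"] by auto

lemma closure_support_partial_deriv:
  "closure {x. partial_deriv i f x \<noteq> 0} \<subseteq> closure {x. f x \<noteq> 0}"
proof (rule closure_minimal)
  show "{x. partial_deriv i f x \<noteq> 0} \<subseteq> closure {x. f x \<noteq> 0}"
  proof (rule ccontr)
    assume "\<not> ?thesis"
    then obtain x where x: "partial_deriv i f x \<noteq> 0" "x \<in> - closure {x. f x \<noteq> 0}"
      by auto
    have "partial_deriv i f x = 0"
      by (rule partial_deriv_zero_on_open[OF _ x(2)]) (simp add: open_Compl, rule zero_off_closed_support, simp)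
    with x show False by simp
  qed
qed simp

lemma test_function_partial_deriv:
  assumes "test_function D \<phi>"
  shows "test_function D (partial_deriv i \<phi>)"
  using assms closure_support_partial_deriv[of i \<phi>]
  unfolding test_function_def
  by (meson closed_closure closed_subset compact_imp_closed closedin_closed_trans closedin_compact order_trans smooth_partial_deriv)

lemma test_function_mono: "test_function D \<phi> \<Longrightarrow> D \<subseteq> D' \<Longrightarrow> test_function D' \<phi>"
  by (auto simp: test_function_def)

lemma test_function_outside: "test_function D \<phi> \<Longrightarrow> x \<notin> D \<Longrightarrow> \<phi> x = 0"
  using closure_subset[of "{x. \<phi> x \<noteq> 0}"] by (auto simp: test_function_def)

text \<open>By the product rule this set is closed under partial derivatives, which makes the product of two
  smooth functions smooth without an explicit Leibniz formula.\<close>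

inductive_set product_sums :: "(real^2 \<Rightarrow> real) set" where
  prod: "smooth f \<Longrightarrow> smooth g \<Longrightarrow> (\<lambda>x. f x * g x) \<in> product_sums"
| add: "h \<in> product_sums \<Longrightarrow> k \<in> product_sums \<Longrightarrow> (\<lambda>x. h x + k x) \<in> product_sums"

lemma product_sums_partial_deriv:
  assumes "h \<in> product_sums"
  shows "h differentiable_on UNIV \<and> (\<forall>i. partial_deriv i h \<in> product_sums)"
  using assms
proof induction
  case (prod f g)
  then have "f differentiable_on UNIV" "g differentiable_on UNIV"
    by (auto intro: smooth_differentiable)
  with prod show ?case
    by (auto simp: partial_deriv_mult intro!: product_sums.intros smooth_partial_deriv differentiable_on_mult)
next
  case (add h k)
  then show ?case
    by (auto simp: partial_deriv_add intro!: product_sums.intros differentiable_on_add)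
qed

lemma smooth_mult:
  assumes "smooth f" "smooth g"
  shows "smooth (\<lambda>x. f x * g x)"
proof -
  have "foldr partial_deriv is (\<lambda>x. f x * g x) \<in> product_sums" for "is"
    using product_sums.prod[OF assms] by (induction "is") (auto dest: product_sums_partial_deriv)
  then show ?thesis
    by (auto simp: smooth_def dest: product_sums_partial_deriv)
qed

lemma test_function_mult:
  assumes "smooth f" "test_function D \<phi>"
  shows "test_function D (\<lambda>x. f x * \<phi> x)"
proof -
  have sub: "closure {x. f x * \<phi> x \<noteq> 0} \<subseteq> closure {x. \<phi> x \<noteq> 0}"
    by (intro closure_mono) auto
  moreover have "compact (closure {x. f x * \<phi> x \<noteq> 0})"
    using compact_Int_closed[of "closure {x. \<phi> x \<noteq> 0}" "closure {x. f x * \<phi> x \<noteq> 0}"] assms(2) sub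
    by (simp add: Int_absorb1 test_function_def)
  ultimately show ?thesis
    using assms by (auto simp: test_function_def smooth_mult)
qed

lemma test_function_partials:
  assumes "test_function D \<phi>"
  shows "test_function D (partials \<alpha> \<phi>)"
proof -
  have "test_function D ((partial_deriv i ^^ n) \<psi>)" if "test_function D \<psi>" for i n \<psi>
    using that by (induction n) (auto intro: test_function_partial_deriv)
  with assms show ?thesis
    by (simp add: partials_def)
qed

section \<open>Weak derivatives\<close>

lemma partials_simps:
  "partials (0, 0) \<phi> = \<phi>"
  "partials (1, 0) \<phi> = partial_deriv 1 \<phi>"
  "partials (0, 1) \<phi> = partial_deriv 2 \<phi>"
  "partials (2, 0) \<phi> = partial_deriv 1 (partial_deriv 1 \<phi>)"
  "partials (1, 1) \<phi> = partial_deriv 1 (partial_deriv 2 \<phi>)"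
  "partials (0, 2) \<phi> = partial_deriv 2 (partial_deriv 2 \<phi>)"
  by (simp_all add: partials_def numeral_2_eq_2)

lemma test_function_translate:
  assumes "\<phi> \<in> cutoff_algebra" "test_function D \<phi>"
  shows "test_function ((\<lambda>x. x + w) ` D) (\<lambda>x. \<phi> (x - w))"
proof -
  let ?C = "(\<lambda>x. x + w) ` closure {x. \<phi> x \<noteq> 0}"
  have c: "compact ?C"
    using assms(2) unfolding test_function_def by (intro compact_continuous_image continuous_intros) auto
  have "{x. \<phi> (x - w) \<noteq> 0} \<subseteq> ?C"
  proof
    fix x assume "x \<in> {x. \<phi> (x - w) \<noteq> 0}"
    then have "x - w \<in> closure {x. \<phi> x \<noteq> 0}"
      using closure_subset[of "{x. \<phi> x \<noteq> 0}"] by auto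
    then show "x \<in> ?C"
      by (intro image_eqI[of _ _ "x - w"]) auto
  qed
  then have sub: "closure {x. \<phi> (x - w) \<noteq> 0} \<subseteq> ?C"
    by (intro closure_minimal compact_imp_closed[OF c])
  then have "compact (closure {x. \<phi> (x - w) \<noteq> 0})"
    using compact_Int_closed[OF c closed_closure, of "{x. \<phi> (x - w) \<noteq> 0}"] by (simp only: Int_absorb1)
  with sub assms show ?thesis
    unfolding test_function_def by (auto intro: cutoff_algebra_smooth cutoff_algebra_translate)
qed

lemma compact_support_bounded:
  fixes f :: "real^2 \<Rightarrow> real"
  assumes "continuous_on UNIV f" "compact (closure {x. f x \<noteq> 0})"
  obtains B where "B \<ge> 0" "\<And>x. \<bar>f x\<bar> \<le> B"
proof -
  have "bounded (f ` closure {x. f x \<noteq> 0})"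
    using assms by (meson compact_continuous_image compact_imp_bounded continuous_on_subset subset_UNIV)
  then obtain B where B: "B > 0" "\<And>x. x \<in> closure {x. f x \<noteq> 0} \<Longrightarrow> \<bar>f x\<bar> \<le> B"
    by (auto simp: bounded_pos)
  have "\<bar>f x\<bar> \<le> B" for x
    using B(1) B(2)[of x] zero_off_closed_support[of x f] by fastforce
  with B that show ?thesis by (meson less_imp_le)
qed

lemma test_function_bounded:
  assumes "test_function D \<phi>"
  obtains B where "B \<ge> 0" "\<And>x. \<bar>\<phi> x\<bar> \<le> B"
  using assms compact_support_bounded[of \<phi>] unfolding test_function_def
  by (metis smooth_continuous)

lemma compact_support_integrable:
  fixes f :: "real^2 \<Rightarrow> real"
  assumes "continuous_on UNIV f" "compact (closure {x. f x \<noteq> 0})"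
  shows "integrable lborel f"
proof -
  have "integrable lborel (\<lambda>x. indicator (closure {x. f x \<noteq> 0}) x *\<^sub>R f x)"
    by (intro borel_integrable_compact assms continuous_on_subset[OF assms(1)]) simp
  also have "(\<lambda>x. indicator (closure {x. f x \<noteq> 0}) x *\<^sub>R f x) = f"
  proof (rule ext)
    fix x
    show "indicator (closure {x. f x \<noteq> 0}) x *\<^sub>R f x = f x"
      using zero_off_closed_support[of x f] by (cases "x \<in> closure {x. f x \<noteq> 0}") auto
  qed
  finally show ?thesis .
qed

lemma test_function_borel [measurable_dest]: "test_function D \<phi> \<Longrightarrow> \<phi> \<in> borel_measurable borel"
  by (intro borel_measurable_continuous_onI smooth_continuous) (simp add: test_function_def)


section \<open>Integrals of derivatives and of translates\<close>

text \<open>The fundamental theorem of calculus on the segment from \<open>x\<close> to \<open>x - v\<close>.\<close>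

lemma integral_derivative_along:
  fixes \<phi> :: "real^2 \<Rightarrow> real"
  assumes "smooth \<phi>"
  shows "(LINT t|lborel. indicator {0..1} t * frechet_derivative \<phi> (at (x - t *\<^sub>R v)) v) = \<phi> x - \<phi> (x - v)"
proof -
  have d: "\<phi> differentiable_on UNIV"
    using assms by (rule smooth_differentiable)
  define F where "F t = - \<phi> (x - t *\<^sub>R v)" for t
  have F: "(F has_real_derivative frechet_derivative \<phi> (at (x - t *\<^sub>R v)) v) (at t)" for t
  proof -
    have "((\<lambda>t. x - t *\<^sub>R v) has_derivative (\<lambda>s. - s *\<^sub>R v)) (at t)"
      by (auto intro!: derivative_eq_intros)
    from has_derivative_compose[OF this has_derivative_frechet[OF d]]
    have "((\<lambda>t. \<phi> (x - t *\<^sub>R v)) has_derivative (\<lambda>s. frechet_derivative \<phi> (at (x - t *\<^sub>R v)) (- s *\<^sub>R v))) (at t)" .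
    from has_derivative_minus[OF this] show ?thesis
      unfolding F_def has_field_derivative_def
      by (rule has_derivative_eq_rhs)
         (simp add: frechet_derivative_real2[OF d] fun_eq_iff algebra_simps)
  qed
  have c: "continuous_on UNIV (\<lambda>t. frechet_derivative \<phi> (at (x - t *\<^sub>R v)) v)"
    unfolding frechet_derivative_real2[OF d]
    by (intro continuous_intros continuous_on_compose2[OF smooth_continuous[OF smooth_partial_deriv[OF assms]]])
       auto
  have "has_bochner_integral lborel (\<lambda>t. frechet_derivative \<phi> (at (x - t *\<^sub>R v)) v * indicator {0..1} t) (F 1 - F 0)"
    using F c by (intro has_bochner_integral_FTC_Icc_real) (auto simp: continuous_on_eq_continuous_at)
  then show ?thesis
    by (auto simp: F_def has_bochner_integral_iff mult.commute)
qed

lemma nn_integral_lborel_translate: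
  fixes f :: "'a::euclidean_space \<Rightarrow> ennreal"
  assumes [measurable]: "f \<in> borel_measurable borel"
  shows "(\<integral>\<^sup>+x. f (x + c) \<partial>lborel) = (\<integral>\<^sup>+x. f x \<partial>lborel)"
proof -
  have "(\<integral>\<^sup>+x. f x \<partial>lborel) = (\<integral>\<^sup>+x. f x \<partial>distr lborel borel ((+) c))"
    by (simp add: lborel_distr_plus)
  then show ?thesis
    by (simp add: nn_integral_distr add.commute)
qed

lemma integral_lborel_translate:
  fixes f :: "'a::euclidean_space \<Rightarrow> real"
  assumes [measurable]: "f \<in> borel_measurable borel"
  shows "(LINT x|lborel. f (x + c)) = (LINT x|lborel. f x)"
proof -
  have "(LINT x|lborel. f x) = (LINT x|distr lborel borel ((+) c). f x)"
    by (simp add: lborel_distr_plus)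
  then show ?thesis
    by (simp add: integral_distr add.commute)
qed

lemma integrable_lborel_translate:
  fixes f :: "'a::euclidean_space \<Rightarrow> real"
  assumes "integrable lborel f"
  shows "integrable lborel (\<lambda>x. f (x + c))"
proof -
  have [measurable]: "f \<in> borel_measurable borel" using assms by auto
  have "integrable (distr lborel borel ((+) c)) f"
    using assms by (simp add: lborel_distr_plus)
  then show ?thesis
    by (simp add: integrable_distr_eq add.commute)
qed

lemma integrable_mult_bounded:
  fixes f \<theta> :: "'a \<Rightarrow> real"
  assumes f: "integrable M f" and \<theta>: "\<theta> \<in> borel_measurable M" and B: "\<And>x. \<bar>\<theta> x\<bar> \<le> B"
  shows "integrable M (\<lambda>x. f x * \<theta> x)"
proof (rule Bochner_Integration.integrable_bound)
  show "integrable M (\<lambda>x. f x * B)"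
    using f by (rule integrable_mult_left)
  show "(\<lambda>x. f x * \<theta> x) \<in> borel_measurable M"
    using borel_measurable_integrable[OF f] \<theta> by (rule borel_measurable_times)
  have "\<bar>\<theta> x\<bar> \<le> \<bar>B\<bar>" for x
    using B[of x] by linarith
  then show "AE x in M. norm (f x * \<theta> x) \<le> norm (f x * B)"
    by (intro AE_I2) (simp add: abs_mult mult_left_mono)
qed

text \<open>The integrability that every use of Fubini's theorem below needs: the integral of \<open>|f (x + t v)|\<close>
  over \<open>x\<close> does not depend on \<open>t\<close>.\<close>

lemma integrable_translates:
  fixes f :: "'a::euclidean_space \<Rightarrow> real" and b :: "'a \<times> real \<Rightarrow> real"
  assumes f: "integrable lborel f"
    and b[measurable]: "b \<in> borel_measurable (borel \<Otimes>\<^sub>M borel)" and B: "\<And>z. \<bar>b z\<bar> \<le> B"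
  shows "integrable (lborel \<Otimes>\<^sub>M lborel) (\<lambda>(x, t). indicator {0..1} t * f (x + t *\<^sub>R v) * b (x, t))"
proof -
  have [measurable]: "f \<in> borel_measurable borel"
    using f by auto
  let ?g = "\<lambda>(x, t). indicator {0..1} t * f (x + t *\<^sub>R v)"
  have "(\<integral>\<^sup>+z. ennreal (norm (?g z)) \<partial>(lborel \<Otimes>\<^sub>M lborel)) =
      (\<integral>\<^sup>+t. \<integral>\<^sup>+x. ennreal (norm (?g (x, t))) \<partial>lborel \<partial>lborel)"
    by (rule lborel_pair.nn_integral_snd[symmetric]) measurable
  also have "\<dots> = (\<integral>\<^sup>+t. indicator {0..1} t * (\<integral>\<^sup>+x. ennreal \<bar>f (x + t *\<^sub>R v)\<bar> \<partial>lborel) \<partial>(lborel :: real measure))"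
    by (intro nn_integral_cong) (auto simp: abs_mult ennreal_mult nn_integral_cmult split: split_indicator)
  also have "\<dots> = (\<integral>\<^sup>+t. indicator {0..1} t * (\<integral>\<^sup>+x. ennreal \<bar>f x\<bar> \<partial>lborel) \<partial>(lborel :: real measure))"
    by (subst nn_integral_lborel_translate) auto
  also have "\<dots> = (\<integral>\<^sup>+x. ennreal \<bar>f x\<bar> \<partial>lborel)"
    by (simp add: nn_integral_multc)
  also have "\<dots> < \<infinity>"
    using f by (simp add: integrable_iff_bounded)
  finally have "integrable (lborel \<Otimes>\<^sub>M lborel) ?g"
    by (intro integrableI_bounded) measurable
  then have "integrable (lborel \<Otimes>\<^sub>M lborel) (\<lambda>z. ?g z * b z)"
    by (rule integrable_mult_bounded) (measurable, rule B)
  then show ?thesis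
    by (simp add: case_prod_unfold)
qed

text \<open>The integral of \<open>\<psi> x - \<psi> (x - v)\<close> vanishes by translation invariance. Writing the difference as
  an integral of the derivative along \<open>v\<close> and exchanging the integrals gives the integral of that
  derivative.\<close>

lemma integral_partial_deriv_eq_0:
  assumes "smooth \<psi>" "compact (closure {x. \<psi> x \<noteq> 0})"
  shows "(LINT x|lborel. partial_deriv i \<psi> x) = 0"
proof -
  have "test_function UNIV \<psi>"
    using assms by (simp add: test_function_def)
  note t = this test_function_partial_deriv[OF this, of i]
  note [measurable] = t[THEN test_function_borel]
  define v :: "real^2" where "v = axis i 1"
  have int: "integrable lborel \<psi>" "integrable lborel (partial_deriv i \<psi>)"
    using t by (auto simp: test_function_def intro!: compact_support_integrable smooth_continuous)
  have "0 = (LINT x|lborel. \<psi> x) - (LINT x|lborel. \<psi> (x + - v))"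
    by (subst integral_lborel_translate) auto
  also have "\<dots> = (LINT x|lborel. \<psi> x - \<psi> (x - v))"
    using int integrable_lborel_translate[OF int(1), of "- v"] by (subst Bochner_Integration.integral_diff) auto
  also have "\<dots> = (LINT x|lborel. LINT t|lborel. indicator {0..1} t * partial_deriv i \<psi> (x - t *\<^sub>R v))"
    using assms by (simp add: integral_derivative_along[symmetric] partial_deriv_def v_def)
  also have "\<dots> = (LINT t|lborel. LINT x|lborel. indicator {0..1} t * partial_deriv i \<psi> (x - t *\<^sub>R v))"
    using integrable_translates[OF int(2), of "\<lambda>_. 1" 1 "- v"]
    by (intro lborel_pair.Fubini_integral[symmetric]) (simp add: case_prod_unfold)
  also have "\<dots> = (LINT t|lborel. indicator {0..1} (t::real) * (LINT x|lborel. partial_deriv i \<psi> (x + - (t *\<^sub>R v))))"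
    by simp
  also have "\<dots> = (LINT x|lborel. partial_deriv i \<psi> x)"
    by (subst integral_lborel_translate) auto
  finally show ?thesis by simp
qed


section \<open>The fundamental lemma of the calculus of variations\<close>

text \<open>A product of four one-sided cutoffs, one for each side of the box. The shift by one makes the
  support lie at distance at least \<open>1/k\<close> from the sides, so that it is a compact subset of the open box.\<close>

definition box_cutoff :: "real^2 \<Rightarrow> real^2 \<Rightarrow> real \<Rightarrow> real^2 \<Rightarrow> real" where
  "box_cutoff a b k x =
     (flat_exp 0 (k * x $ 1 + (- k * a $ 1 - 1)) * flat_exp 0 (- k * x $ 1 + (k * b $ 1 - 1))) *
     (flat_exp 0 (k * x $ 2 + (- k * a $ 2 - 1)) * flat_exp 0 (- k * x $ 2 + (k * b $ 2 - 1)))"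

lemma box_cutoff_in_algebra: "box_cutoff a b k \<in> cutoff_algebra"
  unfolding box_cutoff_def[abs_def] by (intro cutoff_algebra.intros)

lemma flat_exp_0_nonneg: "flat_exp 0 t \<ge> 0" and flat_exp_0_le_1: "flat_exp 0 t \<le> 1"
  by (auto simp: flat_exp_def)

lemma box_cutoff_bound: "\<bar>box_cutoff a b k x\<bar> \<le> 1"
  unfolding box_cutoff_def
  by (simp add: abs_mult abs_of_nonneg[OF flat_exp_0_nonneg])
     (intro mult_le_one mult_nonneg_nonneg flat_exp_0_nonneg flat_exp_0_le_1)

lemma test_function_box_cutoff:
  assumes "k > 0"
  shows "test_function (box a b) (box_cutoff a b k)"
proof -
  let ?Q = "cbox (a + (\<chi> i. 1 / k)) (b - (\<chi> i. 1 / k))"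
  have k: "1 / k > 0"
    using assms by simp
  \<comment> \<open>Each factor vanishes unless its argument, which is \<open>k\<close> times the distance to the side minus one, is positive.\<close>
  have low: "a $ i + 1 / k \<le> x $ i" if "flat_exp 0 (k * x $ i + (- k * a $ i - 1)) \<noteq> 0" for x i
  proof -
    have "k * x $ i + (- k * a $ i - 1) > 0"
      using that by (auto simp: flat_exp_def split: if_splits)
    then have "(k * x $ i - k * a $ i) / k \<ge> 1 / k"
      using assms by (intro divide_right_mono) auto
    with assms show ?thesis by (simp add: diff_divide_distrib)
  qed
  have up: "x $ i \<le> b $ i - 1 / k" if "flat_exp 0 (- k * x $ i + (k * b $ i - 1)) \<noteq> 0" for x i
  proof -
    have "- k * x $ i + (k * b $ i - 1) > 0"
      using that by (auto simp: flat_exp_def split: if_splits)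
    then have "(k * b $ i - k * x $ i) / k \<ge> 1 / k"
      using assms by (intro divide_right_mono) auto
    with assms show ?thesis by (simp add: diff_divide_distrib)
  qed
  have "{x. box_cutoff a b k x \<noteq> 0} \<subseteq> ?Q"
    using low up by (auto simp: box_cutoff_def mem_box_cart forall_2)
  then have sub: "closure {x. box_cutoff a b k x \<noteq> 0} \<subseteq> ?Q"
    by (intro closure_minimal) auto
  moreover have "?Q \<subseteq> box a b"
  proof
    fix x assume "x \<in> ?Q"
    then have "a $ i + 1 / k \<le> x $ i" "x $ i \<le> b $ i - 1 / k" for i
      by (auto simp: mem_box_cart)
    then have "a $ i < x $ i" "x $ i < b $ i" for i
      using k by (smt (verit))+
    then show "x \<in> box a b"
      by (simp add: mem_box_cart)
  qed
  moreover have "compact (closure {x. box_cutoff a b k x \<noteq> 0})"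
    using sub by (meson bounded_cbox bounded_subset closed_closure compact_eq_bounded_closed)
  ultimately show ?thesis
    by (auto simp: test_function_def cutoff_algebra_smooth box_cutoff_in_algebra)
qed

lemma flat_exp_0_tendsto:
  assumes "c > 0"
  shows "(\<lambda>n. flat_exp 0 (real n * c - 1)) \<longlonglongrightarrow> 1"
proof -
  have l: "filterlim (\<lambda>n. real n * c - 1) at_top sequentially"
    using filterlim_tendsto_add_at_top[OF tendsto_const[of "- 1"]
        filterlim_tendsto_pos_mult_at_top[OF tendsto_const assms filterlim_real_sequentially]]
    by (simp add: add.commute mult.commute)
  have "((\<lambda>t::real. exp (- inverse t)) \<longlongrightarrow> exp (- 0)) at_top"
    by (intro tendsto_exp tendsto_minus tendsto_inverse_0_at_top filterlim_ident)
  then have "(\<lambda>n. exp (- inverse (real n * c - 1))) \<longlonglongrightarrow> 1"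
    using filterlim_compose[OF _ l] by fastforce
  then show ?thesis
    by (rule Lim_transform_eventually)
       (use filterlim_at_top_dense[THEN iffD1, OF l, rule_format, of 0] in \<open>auto simp: flat_exp_def elim!: eventually_mono\<close>)
qed

lemma box_cutoff_tendsto: "(\<lambda>n. box_cutoff a b (real n) x) \<longlonglongrightarrow> indicator (box a b) x"
proof (cases "x \<in> box a b")
  case True
  have "(\<lambda>n. (flat_exp 0 (real n * (x $ 1 - a $ 1) - 1) * flat_exp 0 (real n * (b $ 1 - x $ 1) - 1)) *
      (flat_exp 0 (real n * (x $ 2 - a $ 2) - 1) * flat_exp 0 (real n * (b $ 2 - x $ 2) - 1))) \<longlonglongrightarrow> (1 * 1) * (1 * 1)"
    using True by (intro tendsto_mult flat_exp_0_tendsto) (auto simp: mem_box_cart)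
  with True show ?thesis
    by (simp add: box_cutoff_def algebra_simps)
next
  case False
  have "box_cutoff a b (real n) x = 0" for n
  proof (cases "n = 0")
    case False
    then show ?thesis
      using \<open>x \<notin> box a b\<close> test_function_outside[OF test_function_box_cutoff] by simp
  qed (simp add: box_cutoff_def flat_exp_def)
  with False show ?thesis by simp
qed

lemma integral_over_box_eq_0:
  assumes f: "integrable lborel f"
    and test: "\<And>\<phi>. \<phi> \<in> cutoff_algebra \<Longrightarrow> test_function (box a b) \<phi> \<Longrightarrow> (LINT x|lborel. f x * \<phi> x) = 0"
  shows "(LINT x|lborel. f x * indicator (box a b) x) = 0"
proof -
  have [measurable]: "f \<in> borel_measurable borel" using f by auto
  have [measurable]: "box_cutoff a b k \<in> borel_measurable borel" for k
    by (intro borel_measurable_continuous_onI smooth_continuous cutoff_algebra_smooth box_cutoff_in_algebra)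
  have "(\<lambda>n. LINT x|lborel. f x * box_cutoff a b (real n) x) \<longlonglongrightarrow> (LINT x|lborel. f x * indicator (box a b) x)"
  proof (rule integral_dominated_convergence)
    show "integrable lborel (\<lambda>x. \<bar>f x\<bar>)" using f by simp
    show "AE x in lborel. (\<lambda>n. f x * box_cutoff a b (real n) x) \<longlonglongrightarrow> f x * indicator (box a b) x"
      by (intro AE_I2 tendsto_mult tendsto_const box_cutoff_tendsto)
    show "AE x in lborel. norm (f x * box_cutoff a b (real n) x) \<le> \<bar>f x\<bar>" for n
      using box_cutoff_bound by (auto simp: abs_mult mult_left_le)
  qed auto
  moreover have "(LINT x|lborel. f x * box_cutoff a b (real n) x) = 0" for n
  proof (cases "n = 0")
    case False
    then show ?thesis
      by (intro test box_cutoff_in_algebra test_function_box_cutoff) simp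
  qed (simp add: box_cutoff_def flat_exp_def)
  ultimately show ?thesis
    by (simp add: LIMSEQ_const_iff)
qed

text \<open>The cutoffs of smaller boxes show that \<open>f\<close> integrates to zero over every box inside the given one.
  Boxes are stable under intersection and generate the Borel sets, so \<open>f\<close> integrates to zero over
  every Borel subset of the box.\<close>

lemma AE_eq_0_on_box:
  assumes f: "integrable lborel f"
    and test: "\<And>\<phi>. \<phi> \<in> cutoff_algebra \<Longrightarrow> test_function (box a b) \<phi> \<Longrightarrow> (LINT x|lborel. f x * \<phi> x) = 0"
  shows "AE x in lborel. x \<in> box a b \<longrightarrow> f x = 0"
proof -
  have [measurable]: "f \<in> borel_measurable borel" using f by auto
  define g where "g x = f x * indicator (box a b) x" for x
  have g: "integrable lborel g"
    unfolding g_def using f by (intro integrable_real_mult_indicator) auto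
  have Int: "\<exists>c' d'. box c d \<inter> box s t = box c' d'" for c d s t :: "real^2"
    using box_Int_box by blast
  have box: "(LINT x|lborel. indicator (box c d) x * g x) = 0" for c d
  proof -
    obtain c' d' where cd: "box c d \<inter> box a b = box c' d'"
      using Int by blast
    have "(LINT x|lborel. indicator (box c d) x * g x) = (LINT x|lborel. f x * indicator (box c' d') x)"
      unfolding cd[symmetric] g_def by (intro Bochner_Integration.integral_cong) (auto simp: indicator_def)
    also have "\<dots> = 0"
      using cd by (intro integral_over_box_eq_0 f test) (auto elim: test_function_mono)
    finally show ?thesis .
  qed
  have all0: "(LINT x|lborel. g x) = 0"
    using integral_over_box_eq_0[OF f test] by (simp add: g_def)
  have "(LINT x|lborel. indicator S x * g x) = 0" if S: "S \<in> sets borel" for S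
  proof -
    have SS: "S \<in> sigma_sets UNIV (range (\<lambda>(a, b). box a b :: (real^2) set))"
      using S by (simp add: borel_eq_box)
    have "Int_stable (range (\<lambda>(a, b). box a b :: (real^2) set))"
      using Int by (auto simp: Int_stable_def image_iff)
    moreover have "range (\<lambda>(a, b). box a b :: (real^2) set) \<subseteq> Pow UNIV"
      by simp
    ultimately show ?thesis
      using SS
    proof (induction rule: sigma_sets_induct_disjoint)
      case (basic A)
      then show ?case using box by auto
    next
      case (compl A)
      then have [measurable]: "A \<in> sets borel"
        by (simp add: borel_eq_box)
      have "(LINT x|lborel. indicator (UNIV - A) x * g x) = (LINT x|lborel. g x - indicator A x * g x)"
        by (intro Bochner_Integration.integral_cong) (auto simp: indicator_def)
      also have "\<dots> = 0"
        using compl g integrable_mult_indicator[of A lborel g] all0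
        by (subst Bochner_Integration.integral_diff) auto
      finally show ?case .
    next
      case (union A)
      then have [measurable]: "A i \<in> sets borel" for i
        by (auto simp: borel_eq_box)
      have "set_integrable lborel (\<Union>i. A i) g"
        unfolding set_integrable_def using g by (intro integrable_mult_indicator) auto
      then have "(LINT x:(\<Union>i. A i)|lborel. g x) = (\<Sum>i. LINT x:A i|lborel. g x)"
        using union(1) by (intro lebesgue_integral_countable_add) (auto simp: disjoint_family_on_def)
      with union show ?case
        by (simp add: set_lebesgue_integral_def)
    qed simp
  qed
  then have "AE x in lborel. g x = 0"
    by (intro sigma_finite_measure.density_zero[OF sigma_finite_lborel] g) (simp add: set_lebesgue_integral_def)
  then show ?thesis
    by (rule eventually_mono) (auto simp: g_def)
qed

text \<open>An open set is a countable union of closed boxes, and the boundary of a box is a null set.\<close>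

lemma AE_open_by_boxes:
  fixes U :: "'a::euclidean_space set"
  assumes "open U"
    and box: "\<And>a b. cbox a b \<subseteq> U \<Longrightarrow> AE x in lborel. x \<in> box a b \<longrightarrow> P x"
  shows "AE x in lborel. x \<in> U \<longrightarrow> P x"
proof -
  obtain \<D> where D: "countable \<D>" "\<D> \<subseteq> Pow U" "\<And>X. X \<in> \<D> \<Longrightarrow> \<exists>a b. X = cbox a b" "\<Union>\<D> = U"
    using open_countable_Union_open_cbox[OF assms(1)] by metis
  have "AE x in lborel. x \<in> X \<longrightarrow> P x" if XD: "X \<in> \<D>" for X
  proof -
    obtain a b where X: "X = cbox a b" and "cbox a b \<subseteq> U"
      using D(3)[OF XD] D(2) XD by auto
    have "AE x in lebesgue. x \<notin> cbox a b - box a b"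
      using negligible_frontier_interval[of a b] by (intro AE_not_in) (simp add: negligible_iff_null_sets)
    moreover have "AE x in lebesgue. x \<in> box a b \<longrightarrow> P x"
      using box[OF \<open>cbox a b \<subseteq> U\<close>] by (rule AE_completion)
    ultimately have "AE x in lebesgue. x \<in> X \<longrightarrow> P x"
      unfolding X by eventually_elim auto
    then show ?thesis
      by (simp add: AE_completion_iff)
  qed
  then have "AE x in lborel. \<forall>X\<in>\<D>. x \<in> X \<longrightarrow> P x"
    using D(1) by (subst AE_ball_countable) auto
  then show ?thesis
    by (rule eventually_mono) (use D(4) in blast)
qed

text \<open>Products and Fubini's theorem call for Borel functions on the whole plane, whereas weak
  derivatives are only Lebesgue measurable functions on \<open>D\<close>. The function \<open>F\<close> is a Borel representative
  that vanishes outside \<open>D\<close>.\<close>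

definition borel_version :: "(real^2) set \<Rightarrow> (real^2 \<Rightarrow> real) \<Rightarrow> (real^2 \<Rightarrow> real) \<Rightarrow> bool" where
  "borel_version D f F \<longleftrightarrow> F \<in> borel_measurable borel \<and> (\<forall>x. x \<notin> D \<longrightarrow> F x = 0) \<and>
     (\<lambda>x. indicator D x * f x) \<in> borel_measurable lebesgue \<and>
     (AE x in lebesgue. indicator D x * f x = F x)"

text \<open>Measurability on \<open>D\<close> follows by exhausting \<open>D\<close> with compact sets.\<close>

lemma locally_integrable_borel_version:
  assumes "open D" "locally_integrable D f"
  obtains F where "borel_version D f F"
proof -
  obtain C where C: "\<And>n::nat. compact (C n)" "\<And>n. C n \<subseteq> D"
      "\<And>K. compact K \<Longrightarrow> K \<subseteq> D \<Longrightarrow> \<exists>N. \<forall>n\<ge>N. K \<subseteq> C n"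
    using open_Union_compact_subsets[OF assms(1)] by metis
  have [measurable]: "D \<in> sets borel"
    using assms(1) by simp
  have m[measurable]: "(\<lambda>x. indicator D x * f x) \<in> borel_measurable lebesgue"
  proof (rule borel_measurable_LIMSEQ_real)
    show "(\<lambda>n. indicator (C n) x * f x) \<longlonglongrightarrow> indicator D x * f x" for x
    proof (cases "x \<in> D")
      case True
      then obtain N where "\<forall>n\<ge>N. {x} \<subseteq> C n"
        using C(3)[of "{x}"] by auto
      then have "eventually (\<lambda>n. indicator (C n) x * f x = indicator D x * f x) sequentially"
        using True unfolding eventually_sequentially by (intro exI[of _ N]) (auto simp: indicator_def)
      then show ?thesis
        by (rule tendsto_eventually)
    next
      case False
      then have "x \<notin> C n" for n using C(2) by auto
      with False show ?thesis by simp
    qed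
    show "(\<lambda>x. indicator (C n) x * f x) \<in> borel_measurable lebesgue" for n
      using assms(2) C(1,2)[of n]
      by (auto simp: locally_integrable_def set_integrable_def dest!: borel_measurable_integrable)
  qed
  from completion_ex_borel_measurable_real[OF this]
  obtain F where F[measurable]: "F \<in> borel_measurable borel"
    and ae: "AE x in lborel. indicator D x * f x = F x"
    by auto
  have "AE x in lebesgue. indicator D x * f x = indicator D x * F x"
    using AE_completion[OF ae] by eventually_elim (auto simp: indicator_def)
  then have "borel_version D f (\<lambda>x. indicator D x * F x)"
    by (auto simp: borel_version_def m)
  then show ?thesis using that by blast
qed

lemma locally_integrable_measurable:
  assumes "open D" "locally_integrable D f"
  shows "f \<in> borel_measurable (lebesgue_on D)"
proof -
  have "(\<lambda>x. indicator D x * f x) \<in> borel_measurable lebesgue"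
    using locally_integrable_borel_version[OF assms] unfolding borel_version_def by metis
  also have "(\<lambda>x. indicator D x * f x) = (\<lambda>x. if x \<in> D then f x else 0)"
    by (auto simp: indicator_def)
  finally show ?thesis
    by (rule borel_measurable_if_D)
qed

lemma borel_version_mult_integral:
  assumes "borel_version D f F" "open D" and [measurable]: "\<phi> \<in> borel_measurable borel"
  shows "(LINT x|lebesgue_on D. f x * \<phi> x) = (LINT x|lborel. F x * \<phi> x)"
proof -
  have [measurable]: "F \<in> borel_measurable borel" "D \<in> sets borel"
      "(\<lambda>x. indicator D x * f x) \<in> borel_measurable lebesgue"
    using assms by (auto simp: borel_version_def)
  have *: "(\<lambda>x. F x * \<phi> x) \<in> borel_measurable lborel" "\<phi> \<in> borel_measurable lebesgue"
    by (measurable, intro measurable_completion, simp)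
  have "(LINT x|lebesgue_on D. f x * \<phi> x) = (LINT x|lebesgue. (indicator D x * f x) * \<phi> x)"
    by (subst integral_restrict_space) (auto simp: mult.assoc)
  also have "\<dots> = (LINT x|lebesgue. F x * \<phi> x)"
  proof (rule integral_cong_AE)
    show "(\<lambda>x. indicator D x * f x * \<phi> x) \<in> borel_measurable lebesgue"
      by (rule borel_measurable_times[of "\<lambda>x. indicator D x * f x"])
         (use assms(1) *(2) in \<open>simp_all only: borel_version_def\<close>)
    show "(\<lambda>x. F x * \<phi> x) \<in> borel_measurable lebesgue"
      using *(1) by (rule measurable_completion)
    show "AE x in lebesgue. indicator D x * f x * \<phi> x = F x * \<phi> x"
      using assms(1) unfolding borel_version_def by (auto elim: eventually_mono)
  qed
  also have "\<dots> = (LINT x|lborel. F x * \<phi> x)"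
    by (intro integral_completion) simp
  finally show ?thesis .
qed

lemma borel_version_integrable_on_compact:
  assumes "borel_version D f F" "locally_integrable D f" "compact S" "S \<subseteq> D"
  shows "integrable lborel (\<lambda>x. indicator S x * F x)"
proof -
  have [measurable]: "F \<in> borel_measurable borel" "S \<in> sets borel"
    using assms by (auto simp: borel_version_def compact_imp_closed)
  have "integrable lebesgue (\<lambda>x. indicator S x * f x)"
    using assms by (auto simp: locally_integrable_def set_integrable_def)
  moreover have "AE x in lebesgue. indicator S x * f x = indicator S x * F x"
    using assms(1) unfolding borel_version_def
    by (elim conjE, elim eventually_mono) (use assms(4) in \<open>auto simp: indicator_def split: if_splits\<close>)
  moreover have "(\<lambda>x. indicator S x * F x) \<in> borel_measurable lebesgue"
    by (intro measurable_completion) simp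
  ultimately have "integrable lebesgue (\<lambda>x. indicator S x * F x)"
    using integrable_cong_AE_imp by blast
  then show ?thesis
    by (simp add: integrable_completion)
qed

text \<open>The fundamental lemma of the calculus of variations. Testing against the cutoff algebra suffices,
  since it contains the cutoffs of all boxes.\<close>

theorem AE_eq_0_if_orthogonal_to_tests:
  assumes "open D" "locally_integrable D f"
    and test: "\<And>\<phi>. \<phi> \<in> cutoff_algebra \<Longrightarrow> test_function D \<phi> \<Longrightarrow> (LINT x|lebesgue_on D. f x * \<phi> x) = 0"
  shows "AE x in lebesgue_on D. f x = 0"
proof -
  obtain F where F: "borel_version D f F"
    using locally_integrable_borel_version assms by blast
  have "AE x in lborel. x \<in> D \<longrightarrow> F x = 0"
  proof (rule AE_open_by_boxes[OF assms(1)])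
    fix a b assume ab: "cbox a b \<subseteq> D"
    have "AE x in lborel. x \<in> box a b \<longrightarrow> indicator (cbox a b) x * F x = 0"
    proof (rule AE_eq_0_on_box)
      show "integrable lborel (\<lambda>x. indicator (cbox a b) x * F x)"
        using F assms(2) ab by (intro borel_version_integrable_on_compact) auto
    next
      fix \<phi> assume \<phi>: "\<phi> \<in> cutoff_algebra" "test_function (box a b) \<phi>"
      have *: "test_function D \<phi>"
        by (rule test_function_mono[OF \<phi>(2)]) (use ab box_subset_cbox in blast)
      have "(LINT x|lborel. indicator (cbox a b) x * F x * \<phi> x) = (LINT x|lborel. F x * \<phi> x)"
        using test_function_outside[OF \<phi>(2)] box_subset_cbox[of a b]
        by (intro Bochner_Integration.integral_cong) (auto simp: indicator_def)
      also have "\<dots> = (LINT x|lebesgue_on D. f x * \<phi> x)"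
        using test_function_borel[OF *] by (intro borel_version_mult_integral[symmetric] F assms)
      finally show "(LINT x|lborel. indicator (cbox a b) x * F x * \<phi> x) = 0"
        using test[OF \<phi>(1) *] by simp
    qed
    then show "AE x in lborel. x \<in> box a b \<longrightarrow> F x = 0"
      by (rule eventually_mono) (use box_subset_cbox[of a b] in \<open>auto simp: indicator_def split: if_splits\<close>)
  qed
  from AE_completion[OF this] have "AE x in lebesgue. x \<in> D \<longrightarrow> f x = 0"
    using F unfolding borel_version_def by (auto elim: eventually_elim2 simp: indicator_def)
  then show ?thesis
    using assms(1) by (subst AE_restrict_space_iff) auto
qed

section \<open>Increments of weakly differentiable functions\<close>

text \<open>The assumption says that \<open>D\<close> is the derivative of \<open>G\<close> along \<open>v\<close>, tested against the translates of
  test functions by \<open>t v\<close>. The translation in \<open>x\<close> is moved from \<open>G\<close> to \<open>\<phi>\<close>, the increment of \<open>\<phi>\<close> is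
  written as an integral over \<open>t\<close>, and the translation is then moved back to \<open>D\<close>.\<close>

lemma translate_AE_box:
  fixes G D :: "real^2 \<Rightarrow> real"
  assumes G: "integrable lborel G" and D: "integrable lborel D"
    and grad: "\<And>\<phi> t. \<phi> \<in> cutoff_algebra \<Longrightarrow> test_function (box a b) \<phi> \<Longrightarrow> 0 \<le> t \<Longrightarrow> t \<le> 1 \<Longrightarrow>
      (LINT x|lborel. G x * frechet_derivative \<phi> (at (x - t *\<^sub>R v)) v) = - (LINT x|lborel. D x * \<phi> (x - t *\<^sub>R v))"
  shows "AE x in lborel. x \<in> box a b \<longrightarrow>
    G (x + v) - G x = (LINT t|lborel. indicator {0..1} t * D (x + t *\<^sub>R v))"
proof -
  have [measurable]: "G \<in> borel_measurable borel" "D \<in> borel_measurable borel"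
    using G D by auto
  define L where "L x = (LINT t|lborel. indicator {0..1} t * D (x + t *\<^sub>R v))" for x
  have L: "integrable lborel L"
    using lborel_pair.integrable_fst'[OF integrable_translates[OF D, of "\<lambda>_. 1" 1 v]] by (simp add: L_def[abs_def])
  have [measurable]: "L \<in> borel_measurable borel"
    using L by auto
  have Gv: "integrable lborel (\<lambda>x. G (x + v))"
    using G by (rule integrable_lborel_translate)
  have "AE x in lborel. x \<in> box a b \<longrightarrow> G (x + v) - G x - L x = 0"
  proof (rule AE_eq_0_on_box)
    show "integrable lborel (\<lambda>x. G (x + v) - G x - L x)"
      using G Gv L by simp
  next
    fix \<phi> assume \<phi>: "\<phi> \<in> cutoff_algebra" "test_function (box a b) \<phi>"
    then have [measurable]: "\<phi> \<in> borel_measurable borel" and smooth: "smooth \<phi>"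
      and diff: "\<phi> differentiable_on UNIV"
      using test_function_borel by (auto simp: cutoff_algebra_smooth smooth_differentiable)
    define \<phi>' where "\<phi>' x = frechet_derivative \<phi> (at x) v" for x
    obtain B where B: "\<And>x. \<bar>\<phi> x\<bar> \<le> B"
      using test_function_bounded[OF \<phi>(2)] by metis
    obtain B1 where B1: "\<And>x. \<bar>partial_deriv 1 \<phi> x\<bar> \<le> B1"
      using test_function_bounded[OF test_function_partial_deriv[OF \<phi>(2)]] by metis
    obtain B2 where B2: "\<And>x. \<bar>partial_deriv 2 \<phi> x\<bar> \<le> B2"
      using test_function_bounded[OF test_function_partial_deriv[OF \<phi>(2)]] by metis
    have [measurable]: "\<phi>' \<in> borel_measurable borel"
      unfolding \<phi>'_def frechet_derivative_real2[OF diff]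
      using test_function_borel[OF test_function_partial_deriv[OF \<phi>(2)]] by measurable
    have B': "\<bar>\<phi>' x\<bar> \<le> \<bar>v $ 1\<bar> * B1 + \<bar>v $ 2\<bar> * B2" for x
      unfolding \<phi>'_def frechet_derivative_real2[OF diff]
      by (rule order_trans[OF abs_triangle_ineq])
         (intro add_mono, auto simp: abs_mult intro!: mult_left_mono B1 B2)
    have mult_int: "integrable lborel (\<lambda>x. h x * \<phi> (x - c))" if "integrable lborel h" for h c
      using that by (rule integrable_mult_bounded) (use B in auto)
    have "(LINT x|lborel. (G (x + v) - G x - L x) * \<phi> x) =
        (LINT x|lborel. G (x + v) * \<phi> x) - (LINT x|lborel. G x * \<phi> x) - (LINT x|lborel. L x * \<phi> x)"
      using mult_int[OF Gv, of 0] mult_int[OF G, of 0] mult_int[OF L, of 0] by (simp add: left_diff_distrib)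
    also have "(LINT x|lborel. G (x + v) * \<phi> x) = (LINT x|lborel. G x * \<phi> (x - v))"
      using integral_lborel_translate[of "\<lambda>x. G x * \<phi> (x - v)" v] by simp
    also have "(LINT x|lborel. G x * \<phi> (x - v)) - (LINT x|lborel. G x * \<phi> x) =
        - (LINT x|lborel. LINT t|lborel. indicator {0..1} t * G x * \<phi>' (x - t *\<^sub>R v))"
    proof -
      have "(LINT x|lborel. G x * \<phi> (x - v)) - (LINT x|lborel. G x * \<phi> x) =
          - (LINT x|lborel. G x * (\<phi> x - \<phi> (x - v)))"
        using mult_int[OF G, of 0] mult_int[OF G, of v] by (simp add: right_diff_distrib)
      also have "(LINT x|lborel. G x * (\<phi> x - \<phi> (x - v))) =
         (LINT x|lborel. LINT t|lborel. indicator {0..1} t * G x * \<phi>' (x - t *\<^sub>R v))"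
        unfolding \<phi>'_def integral_derivative_along[OF smooth, symmetric]
        by (simp flip: integral_mult_right_zero) (simp add: mult_ac)
      finally show ?thesis .
    qed
    also have "(LINT x|lborel. LINT t|lborel. indicator {0..1} t * G x * \<phi>' (x - t *\<^sub>R v)) =
        (LINT t|lborel. LINT x|lborel. indicator {0..1} t * G x * \<phi>' (x - t *\<^sub>R v))"
      using integrable_translates[OF G, of "\<lambda>(x, t). \<phi>' (x - t *\<^sub>R v)" "\<bar>v $ 1\<bar> * B1 + \<bar>v $ 2\<bar> * B2" 0] B'
      by (intro lborel_pair.Fubini_integral[symmetric]) (simp add: case_prod_unfold)
    also have "\<dots> = (LINT t|lborel. indicator {0..1} t * (LINT x|lborel. G x * \<phi>' (x - t *\<^sub>R v)))"
      by (simp add: mult.assoc)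
    also have "\<dots> = (LINT t|lborel. indicator {0..1} t * - (LINT x|lborel. D (x + t *\<^sub>R v) * \<phi> x))"
    proof (intro Bochner_Integration.integral_cong refl)
      fix t :: real
      have "(LINT x|lborel. D (x + t *\<^sub>R v) * \<phi> x) = (LINT x|lborel. D x * \<phi> (x - t *\<^sub>R v))"
        using integral_lborel_translate[of "\<lambda>x. D x * \<phi> (x - t *\<^sub>R v)" "t *\<^sub>R v"] by simp
      then show "indicator {0..1} t * (LINT x|lborel. G x * \<phi>' (x - t *\<^sub>R v)) =
          indicator {0..1} t * - (LINT x|lborel. D (x + t *\<^sub>R v) * \<phi> x)"
        using grad[OF \<phi>, of t] by (simp add: \<phi>'_def indicator_def)
    qed
    also have "\<dots> = - (LINT t|lborel. LINT x|lborel. indicator {0..1} t * D (x + t *\<^sub>R v) * \<phi> x)"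
      by (simp add: mult.assoc)
    also have "(LINT t|lborel. LINT x|lborel. indicator {0..1} t * D (x + t *\<^sub>R v) * \<phi> x) =
        (LINT x|lborel. LINT t|lborel. indicator {0..1} t * D (x + t *\<^sub>R v) * \<phi> x)"
      using integrable_translates[OF D, of "\<lambda>(x, t). \<phi> x" B v] B
      by (intro lborel_pair.Fubini_integral) (simp add: case_prod_unfold)
    also have "\<dots> = (LINT x|lborel. L x * \<phi> x)"
      by (simp add: L_def)
    finally show "(LINT x|lborel. (G (x + v) - G x - L x) * \<phi> x) = 0"
      by simp
  qed
  then show ?thesis
    by (simp add: L_def)
qed


text \<open>Only test functions from the cutoff algebra occur, because their mixed partial derivatives are
  known to commute.\<close>

definition weak_gradient ::
  "(real^2) set \<Rightarrow> (real^2 \<Rightarrow> real) \<Rightarrow> (real^2 \<Rightarrow> real) \<Rightarrow> (real^2 \<Rightarrow> real) \<Rightarrow> bool" where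
  "weak_gradient K g g1 g2 \<longleftrightarrow>
     locally_integrable K g \<and> locally_integrable K g1 \<and> locally_integrable K g2 \<and>
     (\<forall>\<phi>\<in>cutoff_algebra. test_function K \<phi> \<longrightarrow>
       (LINT x|lebesgue_on K. g x * partial_deriv 1 \<phi> x) = - (LINT x|lebesgue_on K. g1 x * \<phi> x) \<and>
       (LINT x|lebesgue_on K. g x * partial_deriv 2 \<phi> x) = - (LINT x|lebesgue_on K. g2 x * \<phi> x))"

text \<open>The complement is the sum of the closed set \<open>-K\<close> and a compact segment.\<close>

lemma open_segment_interior:
  fixes K :: "'a::real_normed_vector set"
  assumes "open K"
  shows "open {x. \<forall>t\<in>{0..1::real}. x + t *\<^sub>R v \<in> K}"
proof -
  have "compact ((\<lambda>t. - t *\<^sub>R v) ` {0..1})"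
    by (intro compact_continuous_image continuous_intros) auto
  then have "closed (\<Union>x\<in>-K. \<Union>y\<in>(\<lambda>t. - t *\<^sub>R v) ` {0..1}. {x + y})"
    using assms by (intro closed_compact_sums) (auto simp: closed_def)
  moreover have "(\<Union>x\<in>-K. \<Union>y\<in>(\<lambda>t. - t *\<^sub>R v) ` {0..1}. {x + y}) = - {x. \<forall>t\<in>{0..1::real}. x + t *\<^sub>R v \<in> K}"
  proof -
    have "\<exists>k\<in>-K. \<exists>s\<in>{0..1}. x = k + - s *\<^sub>R v" if "x + t *\<^sub>R v \<notin> K" "t \<in> {0..1}" for x t
      using that by (intro bexI[of _ "x + t *\<^sub>R v"] bexI[of _ t]) auto
    then show ?thesis by fastforce
  qed
  ultimately show ?thesis
    by (simp add: open_closed)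
qed

text \<open>The functions involved need only be locally integrable, so \<open>translate_AE_box\<close> is applied to their
  truncations to a compact set that contains all the segments that start in a given box.\<close>

theorem weak_gradient_translate:
  assumes "open K" and wg: "weak_gradient K g g1 g2"
    and bv: "borel_version K g G" "borel_version K g1 G1" "borel_version K g2 G2"
  shows "AE x in lborel. (\<forall>t\<in>{0..1}. x + t *\<^sub>R v \<in> K) \<longrightarrow> G (x + v) - G x =
    (LINT t|lborel. indicator {0..1} t * (v $ 1 * G1 (x + t *\<^sub>R v) + v $ 2 * G2 (x + t *\<^sub>R v)))"
proof -
  let ?U = "{x. \<forall>t\<in>{0..1}. x + t *\<^sub>R v \<in> K}"
  have li: "locally_integrable K g" "locally_integrable K g1" "locally_integrable K g2"
    using wg by (auto simp: weak_gradient_def)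
  have "AE x in lborel. x \<in> ?U \<longrightarrow> G (x + v) - G x =
    (LINT t|lborel. indicator {0..1} t * (v $ 1 * G1 (x + t *\<^sub>R v) + v $ 2 * G2 (x + t *\<^sub>R v)))"
  proof (rule AE_open_by_boxes[OF open_segment_interior[OF assms(1)]])
    fix a b assume ab: "cbox a b \<subseteq> ?U"
    \<comment> \<open>The region swept by the box, which contains the supports of all the translated test functions.\<close>
    define S where "S = (\<lambda>(x, t). x + t *\<^sub>R v) ` (cbox a b \<times> {0..1})"
    have S: "compact S"
      unfolding S_def by (intro compact_continuous_image compact_Times)
        (auto intro!: continuous_intros simp: case_prod_unfold)
    have SK: "S \<subseteq> K"
      using ab by (auto simp: S_def)
    have in_S: "x + t *\<^sub>R v \<in> S" if "x \<in> box a b" "0 \<le> t" "t \<le> 1" for x t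
      using that box_subset_cbox[of a b] by (auto simp: S_def intro!: image_eqI[of _ _ "(x, t)"])
    note int = borel_version_integrable_on_compact[OF bv(1) li(1) S SK]
      borel_version_integrable_on_compact[OF bv(2) li(2) S SK]
      borel_version_integrable_on_compact[OF bv(3) li(3) S SK]
    let ?G = "\<lambda>x. indicator S x * G x"
    let ?D = "\<lambda>x. v $ 1 * (indicator S x * G1 x) + v $ 2 * (indicator S x * G2 x)"
    have "AE x in lborel. x \<in> box a b \<longrightarrow> ?G (x + v) - ?G x = (LINT t|lborel. indicator {0..1} t * ?D (x + t *\<^sub>R v))"
    proof (rule translate_AE_box)
      show "integrable lborel ?G" "integrable lborel ?D"
        using int by simp_all
    next
      fix \<phi> and t :: real
      assume \<phi>: "\<phi> \<in> cutoff_algebra" "test_function (box a b) \<phi>" and t: "0 \<le> t" "t \<le> 1"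
      define \<psi> where "\<psi> x = \<phi> (x - t *\<^sub>R v)" for x
      have diff: "\<phi> differentiable_on UNIV"
        using \<phi>(1) by (intro smooth_differentiable cutoff_algebra_smooth)
      have \<psi>A: "\<psi> \<in> cutoff_algebra"
        unfolding \<psi>_def[abs_def] using \<phi>(1) by (rule cutoff_algebra_translate)
      have \<psi>S: "test_function S \<psi>"
        unfolding \<psi>_def[abs_def] using test_function_translate[OF \<phi>, of "t *\<^sub>R v"]
        by (rule test_function_mono) (use in_S t in auto)
      then have \<psi>K: "test_function K \<psi>"
        using SK by (rule test_function_mono)
      have cut: "indicator S x * F x * \<theta> x = F x * \<theta> x" if "test_function S \<theta>" for F \<theta> x
        using test_function_outside[OF that] by (auto simp: indicator_def)
      have move: "(LINT x|lborel. indicator S x * F x * \<theta> x) = (LINT x|lebesgue_on K. f x * \<theta> x)"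
        and int\<theta>: "integrable lborel (\<lambda>x. indicator S x * F x * \<theta> x)"
        if F: "borel_version K f F" and \<theta>: "test_function S \<theta>"
          and int: "integrable lborel (\<lambda>x. indicator S x * F x)" for f F \<theta>
      proof -
        have [measurable]: "\<theta> \<in> borel_measurable borel"
          using test_function_borel \<theta> by blast
        show "(LINT x|lborel. indicator S x * F x * \<theta> x) = (LINT x|lebesgue_on K. f x * \<theta> x)"
          by (simp only: cut[OF \<theta>] borel_version_mult_integral[OF F assms(1)] \<open>\<theta> \<in> _\<close>)
        obtain B where "\<bar>\<theta> x\<bar> \<le> B" for x
          using test_function_bounded[OF \<open>test_function S \<theta>\<close>] by metis
        then show "integrable lborel (\<lambda>x. indicator S x * F x * \<theta> x)"
          using integrable_mult_bounded[OF int, of \<theta> B] by simp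
      qed
      have p: "frechet_derivative \<phi> (at (x - t *\<^sub>R v)) v =
          v $ 1 * partial_deriv 1 \<psi> x + v $ 2 * partial_deriv 2 \<psi> x" for x
        unfolding \<psi>_def[abs_def] partial_deriv_translate[OF diff] frechet_derivative_real2[OF diff] ..
      note d = test_function_partial_deriv[OF \<psi>S]
      have "(LINT x|lborel. ?G x * frechet_derivative \<phi> (at (x - t *\<^sub>R v)) v) =
          (LINT x|lborel. v $ 1 * (?G x * partial_deriv 1 \<psi> x) + v $ 2 * (?G x * partial_deriv 2 \<psi> x))"
        unfolding p by (simp add: algebra_simps)
      also have "\<dots> = v $ 1 * (LINT x|lborel. ?G x * partial_deriv 1 \<psi> x) + v $ 2 * (LINT x|lborel. ?G x * partial_deriv 2 \<psi> x)"
        using int\<theta>[OF bv(1) d int(1)] by simp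
      also have "\<dots> = v $ 1 * - (LINT x|lebesgue_on K. g1 x * \<psi> x) + v $ 2 * - (LINT x|lebesgue_on K. g2 x * \<psi> x)"
        using wg \<psi>A \<psi>K by (simp only: move[OF bv(1) d int(1)] weak_gradient_def)
      also have "\<dots> = v $ 1 * - (LINT x|lborel. indicator S x * G1 x * \<psi> x) + v $ 2 * - (LINT x|lborel. indicator S x * G2 x * \<psi> x)"
        by (simp only: move[OF bv(2) \<psi>S int(2)] move[OF bv(3) \<psi>S int(3)])
      also have "\<dots> = - (LINT x|lborel. v $ 1 * (indicator S x * G1 x * \<psi> x) + v $ 2 * (indicator S x * G2 x * \<psi> x))"
        using int\<theta>[OF bv(2) \<psi>S int(2)] int\<theta>[OF bv(3) \<psi>S int(3)] by simp
      also have "\<dots> = - (LINT x|lborel. ?D x * \<phi> (x - t *\<^sub>R v))"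
        by (simp add: \<psi>_def algebra_simps)
      finally show "(LINT x|lborel. ?G x * frechet_derivative \<phi> (at (x - t *\<^sub>R v)) v) =
          - (LINT x|lborel. ?D x * \<phi> (x - t *\<^sub>R v))" .
    qed
    then show "AE x in lborel. x \<in> box a b \<longrightarrow> G (x + v) - G x =
      (LINT t|lborel. indicator {0..1} t * (v $ 1 * G1 (x + t *\<^sub>R v) + v $ 2 * G2 (x + t *\<^sub>R v)))"
    proof (rule eventually_mono, intro impI)
      fix x assume x: "x \<in> box a b"
        and eq: "x \<in> box a b \<longrightarrow> ?G (x + v) - ?G x = (LINT t|lborel. indicator {0..1} t * ?D (x + t *\<^sub>R v))"
      have "(LINT t|lborel. indicator {0..1} t * ?D (x + t *\<^sub>R v)) =
         (LINT t|lborel. indicator {0..1} t * (v $ 1 * G1 (x + t *\<^sub>R v) + v $ 2 * G2 (x + t *\<^sub>R v)))"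
        using in_S[OF x] by (intro Bochner_Integration.integral_cong) (auto simp: indicator_def)
      moreover have "x \<in> S" "x + v \<in> S"
        using in_S[OF x, of 0] in_S[OF x, of 1] by auto
      ultimately show "G (x + v) - G x =
         (LINT t|lborel. indicator {0..1} t * (v $ 1 * G1 (x + t *\<^sub>R v) + v $ 2 * G2 (x + t *\<^sub>R v)))"
        using eq x by simp
    qed
  qed
  then show ?thesis by simp
qed

section \<open>A weighted Poincare inequality on star-shaped sets\<close>

text \<open>If the bound failed, shifting \<open>y\<close> by \<open>q\<close>, which has norm less than \<open>r / 2\<close>, would produce a
  segment from the ball to \<open>x\<close> that passes through the origin.\<close>

lemma norm_segment_ge:
  fixes K :: "(real^2) set"
  assumes star: "star_shaped_wrt K (ball z r)" and "0 \<notin> K"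
    and y: "y \<in> ball z (r / 2)" and x: "x \<in> K" and t: "0 \<le> t" "t \<le> 1"
  shows "norm ((1 - t) *\<^sub>R y + t *\<^sub>R x) \<ge> (1 - t) * (r / 2)"
proof (rule ccontr)
  define p where "p = (1 - t) *\<^sub>R y + t *\<^sub>R x"
  assume "\<not> ?thesis"
  then have p: "norm p < (1 - t) * (r / 2)"
    by (simp add: p_def)
  then have t1: "t < 1"
    using t by (cases "t = 1") auto
  define q where "q = (1 / (1 - t)) *\<^sub>R p"
  define y' where "y' = y - q"
  have "norm q < r / 2"
    using p t1 by (simp add: q_def field_simps)
  then have "dist z y' < r"
    using y dist_triangle[of z y' y] by (simp add: y'_def dist_norm)
  moreover have "0 = (1 - t) *\<^sub>R y' + t *\<^sub>R x"
  proof -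
    have "(1 - t) *\<^sub>R q = p"
      using t1 by (simp add: q_def)
    then show ?thesis
      by (simp add: y'_def scaleR_diff_right) (simp add: p_def)
  qed
  then have "0 \<in> closed_segment y' x"
    using t unfolding in_segment by blast
  ultimately have "0 \<in> K"
    using star x unfolding star_shaped_wrt_def by (meson mem_ball subsetD)
  with \<open>0 \<notin> K\<close> show False ..
qed

text \<open>The weight \<open>(1 - t)\<^sup>-\<^sup>\<beta>\<close> on the unit interval; its value at \<open>t = 1\<close> is zero, by the convention for
  powers of zero.\<close>

definition endpoint_weight :: "real \<Rightarrow> real \<Rightarrow> real" where
  "endpoint_weight \<beta> t = indicator {0..1} t * (1 - t) powr (- \<beta>)"

lemma endpoint_weight_nonneg: "endpoint_weight \<beta> t \<ge> 0"
  by (simp add: endpoint_weight_def)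

lemma endpoint_weight_borel [measurable]: "endpoint_weight \<beta> \<in> borel_measurable borel"
  unfolding endpoint_weight_def[abs_def] by measurable

lemma nn_integral_endpoint_weight:
  assumes "\<beta> < 1"
  shows "(\<integral>\<^sup>+t. ennreal (endpoint_weight \<beta> t) \<partial>lborel) = ennreal (1 / (1 - \<beta>))"
proof -
  have "(\<integral>\<^sup>+t. ennreal (endpoint_weight \<beta> t) \<partial>lborel) = (\<integral>\<^sup>+t. ennreal (endpoint_weight \<beta> (1 - t)) \<partial>lborel)"
    by (subst nn_integral_real_affine[where c = "- 1" and t = 1]) auto
  also have "\<dots> = (\<integral>\<^sup>+t. ennreal (indicator {0..1} t * t powr (- \<beta>)) \<partial>lborel)"
    by (intro nn_integral_cong) (auto simp: endpoint_weight_def indicator_def)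
  also have "\<dots> = ennreal (1 / (1 - \<beta>))"
    using has_integral_powr_from_0[of "- \<beta>" 1] assms
    by (intro nn_integral_has_integral_lebesgue) auto
  finally show ?thesis .
qed

text \<open>Substitution in the plane: the Jacobian \<open>c\<^sup>2\<close> is at least \<open>1/4\<close>.\<close>

lemma nn_integral_affine_le:
  fixes f :: "real^2 \<Rightarrow> ennreal"
  assumes [measurable]: "f \<in> borel_measurable borel" and c: "c \<ge> 1 / 2"
  shows "(\<integral>\<^sup>+x. f (a + c *\<^sub>R x) \<partial>lborel) \<le> 4 * (\<integral>\<^sup>+x. f x \<partial>lborel)"
proof -
  have c0: "c \<noteq> 0" and "(1 / 2)\<^sup>2 \<le> c\<^sup>2"
    using c by (auto intro!: power_mono)
  then have c2: "ennreal 1 \<le> ennreal (4 * c\<^sup>2)"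
    by (intro ennreal_leI) (simp add: power2_eq_square)
  have "(\<integral>\<^sup>+x. f (a + c *\<^sub>R x) \<partial>lborel) \<le> (\<integral>\<^sup>+x. ennreal (4 * c\<^sup>2) * f (a + c *\<^sub>R x) \<partial>lborel)"
    using mult_right_mono[OF c2] by (intro nn_integral_mono) simp
  also have "\<dots> = 4 * (\<integral>\<^sup>+x. ennreal (c\<^sup>2) * f (a + c *\<^sub>R x) \<partial>lborel)"
    by (simp add: ennreal_mult mult.assoc nn_integral_cmult)
  also have "(\<integral>\<^sup>+x. ennreal (c\<^sup>2) * f (a + c *\<^sub>R x) \<partial>lborel) = (\<integral>\<^sup>+x. f x \<partial>lborel)"
  proof -
    have "(\<integral>\<^sup>+x. f x \<partial>lborel) = (\<integral>\<^sup>+x. f x \<partial>density (distr lborel borel (\<lambda>x. a + c *\<^sub>R x)) (\<lambda>_. ennreal (\<bar>c\<bar> ^ DIM(real^2))))"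
      using lborel_affine[OF c0, of a] by simp
    also have "\<dots> = (\<integral>\<^sup>+x. ennreal (c\<^sup>2) * f (a + c *\<^sub>R x) \<partial>lborel)"
      by (subst nn_integral_density) (auto simp: nn_integral_distr)
    finally show ?thesis ..
  qed
  finally show ?thesis .
qed

lemma powr_square: "((x::real) powr a)\<^sup>2 = x powr (2 * a)"
  by (simp add: power2_eq_square powr_add[symmetric])

text \<open>The lower bound on the segment gives
  \<open>1 \<le> ((1 - t) \<rho>)\<^sup>-\<^sup>\<beta> |y + t v|\<^sup>\<beta>\<close>, which inserts the weight. The factor \<open>(1 - t)\<^sup>-\<^sup>\<beta>\<close> is divided
  equally between the two factors of the Cauchy-Schwarz inequality, where each half becomes an
  integrable function of \<open>t\<close>.\<close>

lemma line_integral_weighted_bound: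
  fixes G1 G2 :: "real^2 \<Rightarrow> real"
  assumes [measurable]: "G1 \<in> borel_measurable borel" "G2 \<in> borel_measurable borel"
    and \<rho>: "\<rho> > 0" and \<beta>: "0 \<le> \<beta>" "\<beta> < 1"
    and low: "\<And>t. 0 \<le> t \<Longrightarrow> t \<le> 1 \<Longrightarrow> norm (y + t *\<^sub>R v) \<ge> (1 - t) * \<rho>"
  shows "ennreal ((LINT t|lborel. indicator {0..1} t * (v $ 1 * G1 (y + t *\<^sub>R v) + v $ 2 * G2 (y + t *\<^sub>R v)))\<^sup>2) \<le>
    ennreal ((norm v)\<^sup>2 * \<rho> powr (- 2 * \<beta>) / (1 - \<beta>)) *
    (\<integral>\<^sup>+t. ennreal (endpoint_weight \<beta> t) * ennreal (norm (y + t *\<^sub>R v) powr (2 * \<beta>) *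
        ((G1 (y + t *\<^sub>R v))\<^sup>2 + (G2 (y + t *\<^sub>R v))\<^sup>2)) \<partial>lborel)"
proof -
  define F where "F t = indicator {0..1} t * (v $ 1 * G1 (y + t *\<^sub>R v) + v $ 2 * G2 (y + t *\<^sub>R v))" for t
  define w where "w t = norm (y + t *\<^sub>R v) powr \<beta> * sqrt ((G1 (y + t *\<^sub>R v))\<^sup>2 + (G2 (y + t *\<^sub>R v))\<^sup>2)" for t
  define c where "c = norm v * \<rho> powr (- \<beta>)"
  have [measurable]: "F \<in> borel_measurable borel" "w \<in> borel_measurable borel"
    unfolding F_def[abs_def] w_def[abs_def] by measurable
  have c: "c \<ge> 0" and w: "w t \<ge> 0" for t
    by (simp_all add: c_def w_def)
  have F: "\<bar>F t\<bar> \<le> c * endpoint_weight \<beta> t * w t" if "t \<noteq> 1" for t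
  proof (cases "t \<in> {0..1}")
    case True
    with that have t: "0 \<le> t" "t < 1" by auto
    define p where "p = y + t *\<^sub>R v"
    define n where "n = sqrt ((G1 p)\<^sup>2 + (G2 p)\<^sup>2)"
    have n: "n \<ge> 0" by (simp add: n_def)
    have "\<bar>v $ 1 * G1 p + v $ 2 * G2 p\<bar> \<le> norm v * n"
    proof -
      have "norm v = sqrt ((v $ 1)\<^sup>2 + (v $ 2)\<^sup>2)"
        by (simp add: norm_vec_def L2_set_def UNIV_2)
      moreover have "(v $ 1 * G1 p + v $ 2 * G2 p)\<^sup>2 \<le> ((v $ 1)\<^sup>2 + (v $ 2)\<^sup>2) * ((G1 p)\<^sup>2 + (G2 p)\<^sup>2)"
        using zero_le_power2[of "v $ 1 * G2 p - v $ 2 * G1 p"] by (simp add: power2_eq_square algebra_simps)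
      ultimately show ?thesis
        by (simp add: n_def real_sqrt_mult[symmetric] real_le_rsqrt real_sqrt_abs[symmetric] del: real_sqrt_abs)
    qed
    also have "norm v * n \<le> norm v * (((1 - t) * \<rho>) powr (- \<beta>) * (norm p powr \<beta> * n))"
    proof -
      have pos: "(1 - t) * \<rho> > 0"
        using t \<rho> by simp
      have "1 = ((1 - t) * \<rho>) powr (- \<beta>) * ((1 - t) * \<rho>) powr \<beta>"
        using t \<rho> by (simp add: powr_add[symmetric])
      also have "\<dots> \<le> ((1 - t) * \<rho>) powr (- \<beta>) * norm p powr \<beta>"
        using low[of t] t pos \<beta> by (intro mult_left_mono powr_mono2) (auto simp: p_def)
      finally have "1 * n \<le> ((1 - t) * \<rho>) powr (- \<beta>) * norm p powr \<beta> * n"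
        using n by (rule mult_right_mono)
      then show ?thesis
        by (intro mult_left_mono) (auto simp: mult.assoc)
    qed
    also have "\<dots> = c * endpoint_weight \<beta> t * w t"
      using True \<rho> t by (simp add: c_def endpoint_weight_def w_def n_def p_def powr_mult)
    finally show ?thesis
      using True by (simp add: F_def p_def)
  qed (simp add: F_def endpoint_weight_def)
  \<comment> \<open>If \<open>F\<close> is not integrable, its Bochner integral is zero by convention and the bound holds trivially.\<close>
  have abs_le: "ennreal \<bar>LINT t|lborel. F t\<bar> \<le> (\<integral>\<^sup>+t. ennreal \<bar>F t\<bar> \<partial>lborel)"
  proof (cases "integrable lborel F")
    case True
    from integral_norm_bound_ennreal[OF this] show ?thesis by simp
  qed (simp add: not_integrable_integral_eq)
  also have "\<dots> \<le> (\<integral>\<^sup>+t. ennreal (c * sqrt (endpoint_weight \<beta> t)) * ennreal (sqrt (endpoint_weight \<beta> t) * w t) \<partial>lborel)"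
  proof (rule nn_integral_mono_AE)
    have "AE t in lborel. t \<noteq> (1 :: real)"
      by (rule AE_lborel_singleton)
    then show "AE t in lborel. ennreal \<bar>F t\<bar> \<le> ennreal (c * sqrt (endpoint_weight \<beta> t)) * ennreal (sqrt (endpoint_weight \<beta> t) * w t)"
    proof eventually_elim
      case (elim t)
      have eq: "c * endpoint_weight \<beta> t * w t = (c * sqrt (endpoint_weight \<beta> t)) * (sqrt (endpoint_weight \<beta> t) * w t)"
        using endpoint_weight_nonneg[of \<beta> t] by (simp add: mult.assoc[symmetric] real_sqrt_mult_self)
      then show ?case
        using F[OF elim] c endpoint_weight_nonneg[of \<beta> t] w unfolding eq
        by (subst ennreal_mult[symmetric]) (auto intro!: ennreal_leI)
    qed
  qed
  finally have le: "ennreal \<bar>LINT t|lborel. F t\<bar> \<le> \<dots>" .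
  have "ennreal ((LINT t|lborel. F t)\<^sup>2) = (ennreal \<bar>LINT t|lborel. F t\<bar>)\<^sup>2"
    by (simp add: ennreal_power)
  also have "\<dots> \<le> (\<integral>\<^sup>+t. ennreal (c * sqrt (endpoint_weight \<beta> t)) * ennreal (sqrt (endpoint_weight \<beta> t) * w t) \<partial>lborel)\<^sup>2"
    by (intro power_mono le) simp
  also have "\<dots> \<le> (\<integral>\<^sup>+t. (ennreal (c * sqrt (endpoint_weight \<beta> t)))\<^sup>2 \<partial>lborel) * (\<integral>\<^sup>+t. (ennreal (sqrt (endpoint_weight \<beta> t) * w t))\<^sup>2 \<partial>lborel)"
    by (rule Cauchy_Schwarz_nn_integral) measurable
  also have "(\<integral>\<^sup>+t. (ennreal (c * sqrt (endpoint_weight \<beta> t)))\<^sup>2 \<partial>lborel) = (\<integral>\<^sup>+t. ennreal (c\<^sup>2) * ennreal (endpoint_weight \<beta> t) \<partial>lborel)"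
    using c endpoint_weight_nonneg by (intro nn_integral_cong) (simp add: ennreal_power power_mult_distrib ennreal_mult)
  also have "\<dots> = ennreal (c\<^sup>2) * ennreal (1 / (1 - \<beta>))"
    by (simp add: nn_integral_cmult nn_integral_endpoint_weight \<beta>)
  also have "\<dots> = ennreal ((norm v)\<^sup>2 * \<rho> powr (- 2 * \<beta>) / (1 - \<beta>))"
    using \<beta> by (simp add: ennreal_mult[symmetric] c_def power_mult_distrib powr_square)
  also have "(\<integral>\<^sup>+t. (ennreal (sqrt (endpoint_weight \<beta> t) * w t))\<^sup>2 \<partial>lborel) = (\<integral>\<^sup>+t. ennreal (endpoint_weight \<beta> t) * ennreal (norm (y + t *\<^sub>R v) powr (2 * \<beta>) *
        ((G1 (y + t *\<^sub>R v))\<^sup>2 + (G2 (y + t *\<^sub>R v))\<^sup>2)) \<partial>lborel)"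
    using w endpoint_weight_nonneg
    by (intro nn_integral_cong)
       (simp add: ennreal_power power_mult_distrib ennreal_mult w_def powr_square)
  finally show ?thesis
    by (simp add: F_def)
qed

text \<open>The point of the segment is substituted for whichever of \<open>x\<close> and \<open>y\<close> has a coefficient of at least
  \<open>1/2\<close>; the other variable contributes the measure of its domain.\<close>

lemma double_segment_integral_le:
  fixes W :: "real^2 \<Rightarrow> ennreal"
  assumes [measurable]: "W \<in> borel_measurable borel" "A \<in> sets borel" "B \<in> sets borel"
    and "emeasure lborel A \<le> m" "emeasure lborel B \<le> m" and t: "0 \<le> t" "t \<le> 1"
  shows "(\<integral>\<^sup>+y. \<integral>\<^sup>+x. indicator A y * indicator B x * W ((1 - t) *\<^sub>R y + t *\<^sub>R x) \<partial>lborel \<partial>lborel)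
    \<le> 4 * m * (\<integral>\<^sup>+x. W x \<partial>lborel)"
proof (cases "t \<ge> 1 / 2")
  case True
  have "(\<integral>\<^sup>+y. \<integral>\<^sup>+x. indicator A y * indicator B x * W ((1 - t) *\<^sub>R y + t *\<^sub>R x) \<partial>lborel \<partial>lborel)
    \<le> (\<integral>\<^sup>+y. indicator A y * (\<integral>\<^sup>+x. W ((1 - t) *\<^sub>R y + t *\<^sub>R x) \<partial>lborel) \<partial>lborel)"
    by (subst nn_integral_cmult[symmetric], measurable)
       (intro nn_integral_mono, auto simp: indicator_def)
  also have "\<dots> \<le> (\<integral>\<^sup>+y. indicator A y * (4 * (\<integral>\<^sup>+x. W x \<partial>lborel)) \<partial>lborel)"
    using True by (intro nn_integral_mono mult_left_mono nn_integral_affine_le) auto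
  also have "\<dots> = emeasure lborel A * (4 * (\<integral>\<^sup>+x. W x \<partial>lborel))"
    by (simp add: nn_integral_multc)
  also have "\<dots> \<le> m * (4 * (\<integral>\<^sup>+x. W x \<partial>lborel))"
    by (intro mult_right_mono assms) auto
  finally show ?thesis by (simp add: mult_ac)
next
  case False
  have "(\<integral>\<^sup>+y. \<integral>\<^sup>+x. indicator A y * indicator B x * W ((1 - t) *\<^sub>R y + t *\<^sub>R x) \<partial>lborel \<partial>lborel)
    = (\<integral>\<^sup>+x. \<integral>\<^sup>+y. indicator A y * indicator B x * W ((1 - t) *\<^sub>R y + t *\<^sub>R x) \<partial>lborel \<partial>lborel)"
    by (rule lborel_pair.Fubini') measurable
  also have "\<dots> \<le> (\<integral>\<^sup>+x. indicator B x * (\<integral>\<^sup>+y. W (t *\<^sub>R x + (1 - t) *\<^sub>R y) \<partial>lborel) \<partial>lborel)"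
    by (subst nn_integral_cmult[symmetric], measurable)
       (intro nn_integral_mono, auto simp: indicator_def add.commute)
  also have "\<dots> \<le> (\<integral>\<^sup>+x. indicator B x * (4 * (\<integral>\<^sup>+x. W x \<partial>lborel)) \<partial>lborel)"
    using False by (intro nn_integral_mono mult_left_mono nn_integral_affine_le) auto
  also have "\<dots> = emeasure lborel B * (4 * (\<integral>\<^sup>+x. W x \<partial>lborel))"
    by (simp add: nn_integral_multc)
  also have "\<dots> \<le> m * (4 * (\<integral>\<^sup>+x. W x \<partial>lborel))"
    by (intro mult_right_mono assms) auto
  finally show ?thesis by (simp add: mult_ac)
qed

text \<open>If \<open>F\<close> exceeded \<open>m\<close> on all of \<open>B\<close>, the excess \<open>F - m\<close> would have integral zero over \<open>B\<close> and hence
  vanish almost everywhere on \<open>B\<close>, which is not a null set.\<close>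

lemma nn_integral_mean_value:
  assumes [measurable]: "F \<in> borel_measurable M" "B \<in> sets M"
    and B: "emeasure M B \<noteq> 0" "emeasure M B \<noteq> \<infinity>"
    and le: "(\<integral>\<^sup>+y. indicator B y * F y \<partial>M) \<le> m * emeasure M B"
  obtains y where "y \<in> B" "F y \<le> (m :: ennreal)"
proof (cases "\<exists>y\<in>B. F y \<le> m")
  case False
  then have less: "m < F y" if "y \<in> B" for y
    using that by (meson not_le)
  have "B \<noteq> {}"
    using B by auto
  then have m: "m \<noteq> \<infinity>"
    using less by fastforce
  have "(\<integral>\<^sup>+y. indicator B y * F y \<partial>M) = (\<integral>\<^sup>+y. m * indicator B y + indicator B y * (F y - m) \<partial>M)"
    using less by (intro nn_integral_cong) (auto simp: indicator_def add_diff_inverse_ennreal less_imp_le)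
  also have "\<dots> = m * emeasure M B + (\<integral>\<^sup>+y. indicator B y * (F y - m) \<partial>M)"
    by (simp add: nn_integral_add nn_integral_cmult)
  finally have "m * emeasure M B + (\<integral>\<^sup>+y. indicator B y * (F y - m) \<partial>M) \<le> m * emeasure M B + 0"
    using le by simp
  then have "(\<integral>\<^sup>+y. indicator B y * (F y - m) \<partial>M) = 0"
    using m B by (subst (asm) ennreal_add_left_cancel_le) (auto simp: ennreal_mult_eq_top_iff)
  then have "AE y in M. indicator B y * (F y - m) = 0"
    by (subst (asm) nn_integral_0_iff_AE) auto
  then have "AE y in M. y \<notin> B"
    by (rule eventually_mono)
       (use less in \<open>fastforce simp: indicator_def diff_eq_0_iff_ennreal split: if_splits dest: leD\<close>)
  then have "emeasure M B = 0"
    by (subst (asm) AE_iff_measurable[of B]) (use sets.sets_into_space[of B M] in auto)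
  with B show ?thesis by simp
qed (use that in blast)


lemma borel_version_nn_integral:
  assumes "open K" and [measurable]: "H \<in> borel_measurable borel"
    and "AE x in lebesgue. indicator K x * h x = (indicator K x * H x :: ennreal)"
  shows "(\<integral>\<^sup>+x. h x \<partial>lebesgue_on K) = (\<integral>\<^sup>+x. indicator K x * H x \<partial>lborel)"
proof -
  have [measurable]: "K \<in> sets borel" using assms(1) by simp
  have "(\<integral>\<^sup>+x. h x \<partial>lebesgue_on K) = (\<integral>\<^sup>+x. indicator K x * h x \<partial>lebesgue)"
    using assms(1) by (simp add: nn_integral_restrict_space mult.commute)
  also have "\<dots> = (\<integral>\<^sup>+x. indicator K x * H x \<partial>lebesgue)"
    by (intro nn_integral_cong_AE assms)
  also have "\<dots> = (\<integral>\<^sup>+x. indicator K x * H x \<partial>lborel)"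
    by (rule nn_integral_completion)
  finally show ?thesis .
qed

text \<open>The formula for increments holds for almost every \<open>y\<close> once \<open>v = x - y\<close> is fixed. So the double
  integral is taken over \<open>y\<close> and \<open>v\<close>, with \<open>y\<close> innermost for the estimate, and is then transformed back
  to the variables \<open>x\<close> and \<open>y\<close>.\<close>

lemma double_integral_of_differences:
  fixes K :: "(real^2) set"
  assumes "open K" and sub: "ball z r \<subseteq> K" and star: "star_shaped_wrt K (ball z r)" and "0 \<notin> K"
    and r: "r > 0" and diam: "\<And>x y. x \<in> K \<Longrightarrow> y \<in> K \<Longrightarrow> dist x y \<le> h"
    and \<beta>: "0 \<le> \<beta>" "\<beta> < 1"
    and wg: "weak_gradient K g g1 g2"
    and bv: "borel_version K g G" "borel_version K g1 G1" "borel_version K g2 G2"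
  shows "(\<integral>\<^sup>+y. \<integral>\<^sup>+x. indicator (ball z (r / 2)) y * indicator K x * ennreal ((G x - G y)\<^sup>2) \<partial>lborel \<partial>lborel) \<le>
    ennreal (h\<^sup>2 * (r / 2) powr (- 2 * \<beta>) / (1 - \<beta>)) * (ennreal (1 / (1 - \<beta>)) *
     (4 * emeasure lborel K * (\<integral>\<^sup>+x. ennreal (norm x powr (2 * \<beta>) * ((G1 x)\<^sup>2 + (G2 x)\<^sup>2)) \<partial>lborel)))"
proof -
  have [measurable]: "K \<in> sets borel" "G \<in> borel_measurable borel"
      "G1 \<in> borel_measurable borel" "G2 \<in> borel_measurable borel"
    using assms(1) bv by (auto simp: borel_version_def)
  let ?B = "ball z (r / 2)"
  have [measurable]: "?B \<in> sets borel" by simp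
  have BK: "?B \<subseteq> K"
    by (rule order_trans[OF subset_ball sub]) (use r in simp)
  define W where "W x = ennreal (norm x powr (2 * \<beta>) * ((G1 x)\<^sup>2 + (G2 x)\<^sup>2))" for x
  have [measurable]: "W \<in> borel_measurable borel"
    unfolding W_def[abs_def] by measurable
  define c where "c = h\<^sup>2 * (r / 2) powr (- 2 * \<beta>) / (1 - \<beta>)"
  have key: "AE y in lborel. indicator ?B y * indicator K (y + v) * ennreal ((G (y + v) - G y)\<^sup>2) \<le>
      indicator ?B y * indicator K (y + v) * (ennreal c * (\<integral>\<^sup>+t. ennreal (endpoint_weight \<beta> t) * W (y + t *\<^sub>R v) \<partial>lborel))" for v
    using weak_gradient_translate[OF assms(1) wg bv, of v]
  proof eventually_elim
    case (elim y)
    show ?case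
    proof (cases "y \<in> ?B \<and> y + v \<in> K")
      case True
      have yr: "y \<in> ball z r"
        using True r by auto
      have seg: "y + t *\<^sub>R v = (1 - t) *\<^sub>R y + t *\<^sub>R (y + v)" for t
        by (simp add: algebra_simps)
      have inK: "y + t *\<^sub>R v \<in> K" if "t \<in> {0..1}" for t
      proof -
        have "y + t *\<^sub>R v \<in> closed_segment y (y + v)"
          using that by (subst seg) (auto simp: in_segment)
        then show ?thesis
          using star yr True unfolding star_shaped_wrt_def by blast
      qed
      have low: "norm (y + t *\<^sub>R v) \<ge> (1 - t) * (r / 2)" if "0 \<le> t" "t \<le> 1" for t
        unfolding seg using True that by (intro norm_segment_ge[OF star \<open>0 \<notin> K\<close>]) auto
      have "norm v \<le> h"
        using diam[of y "y + v"] True BK by (auto simp: dist_norm)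
      then have vc: "(norm v)\<^sup>2 * (r / 2) powr (- 2 * \<beta>) / (1 - \<beta>) \<le> c"
        unfolding c_def using \<beta> by (intro divide_right_mono mult_right_mono power_mono) auto
      have "ennreal ((G (y + v) - G y)\<^sup>2) \<le> ennreal ((norm v)\<^sup>2 * (r / 2) powr (- 2 * \<beta>) / (1 - \<beta>)) *
          (\<integral>\<^sup>+t. ennreal (endpoint_weight \<beta> t) * W (y + t *\<^sub>R v) \<partial>lborel)"
        unfolding elim[rule_format, OF inK, simplified] W_def using r \<beta> low
        by (intro line_integral_weighted_bound) auto
      also have "\<dots> \<le> ennreal c * (\<integral>\<^sup>+t. ennreal (endpoint_weight \<beta> t) * W (y + t *\<^sub>R v) \<partial>lborel)"
        by (intro mult_right_mono ennreal_leI vc) simp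
      finally show ?thesis
        using True by simp
    qed auto
  qed
  have "(\<integral>\<^sup>+y. \<integral>\<^sup>+x. indicator ?B y * indicator K x * ennreal ((G x - G y)\<^sup>2) \<partial>lborel \<partial>lborel) =
      (\<integral>\<^sup>+y. \<integral>\<^sup>+v. indicator ?B y * indicator K (y + v) * ennreal ((G (y + v) - G y)\<^sup>2) \<partial>lborel \<partial>lborel)"
  proof (rule nn_integral_cong)
    fix y :: "real^2"
    show "(\<integral>\<^sup>+x. indicator ?B y * indicator K x * ennreal ((G x - G y)\<^sup>2) \<partial>lborel) =
        (\<integral>\<^sup>+v. indicator ?B y * indicator K (y + v) * ennreal ((G (y + v) - G y)\<^sup>2) \<partial>lborel)"
      unfolding add.commute[of y] by (rule nn_integral_lborel_translate[symmetric]) measurable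
  qed
  also have "\<dots> = (\<integral>\<^sup>+v. \<integral>\<^sup>+y. indicator ?B y * indicator K (y + v) * ennreal ((G (y + v) - G y)\<^sup>2) \<partial>lborel \<partial>lborel)"
    by (rule lborel_pair.Fubini') measurable
  also have "\<dots> \<le> (\<integral>\<^sup>+v. \<integral>\<^sup>+y. indicator ?B y * indicator K (y + v) * (ennreal c * (\<integral>\<^sup>+t. ennreal (endpoint_weight \<beta> t) * W (y + t *\<^sub>R v) \<partial>lborel)) \<partial>lborel \<partial>lborel)"
    by (intro nn_integral_mono nn_integral_mono_AE key)
  also have "\<dots> = (\<integral>\<^sup>+y. \<integral>\<^sup>+v. indicator ?B y * indicator K (y + v) * (ennreal c * (\<integral>\<^sup>+t. ennreal (endpoint_weight \<beta> t) * W (y + t *\<^sub>R v) \<partial>lborel)) \<partial>lborel \<partial>lborel)"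
    by (rule lborel_pair.Fubini') measurable
  also have "\<dots> = (\<integral>\<^sup>+y. \<integral>\<^sup>+x. indicator ?B y * indicator K x * (ennreal c * (\<integral>\<^sup>+t. ennreal (endpoint_weight \<beta> t) * W ((1 - t) *\<^sub>R y + t *\<^sub>R x) \<partial>lborel)) \<partial>lborel \<partial>lborel)"
  proof (rule nn_integral_cong)
    fix y :: "real^2"
    define H where "H x = indicator ?B y * indicator K x *
      (ennreal c * (\<integral>\<^sup>+t. ennreal (endpoint_weight \<beta> t) * W ((1 - t) *\<^sub>R y + t *\<^sub>R x) \<partial>lborel))" for x
    have [measurable]: "H \<in> borel_measurable borel"
      unfolding H_def[abs_def] by measurable
    have seg: "(1 - t) *\<^sub>R y + t *\<^sub>R (v + y) = y + t *\<^sub>R v" for t v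
      by (simp add: algebra_simps)
    have "(\<integral>\<^sup>+v. H (v + y) \<partial>lborel) = (\<integral>\<^sup>+x. H x \<partial>lborel)"
      by (rule nn_integral_lborel_translate) measurable
    then show "(\<integral>\<^sup>+v. indicator ?B y * indicator K (y + v) * (ennreal c * (\<integral>\<^sup>+t. ennreal (endpoint_weight \<beta> t) * W (y + t *\<^sub>R v) \<partial>lborel)) \<partial>lborel) =
        (\<integral>\<^sup>+x. indicator ?B y * indicator K x * (ennreal c * (\<integral>\<^sup>+t. ennreal (endpoint_weight \<beta> t) * W ((1 - t) *\<^sub>R y + t *\<^sub>R x) \<partial>lborel)) \<partial>lborel)"
      unfolding H_def seg by (simp only: add.commute[of _ y])
  qed
  also have "\<dots> = (\<integral>\<^sup>+y. \<integral>\<^sup>+x. \<integral>\<^sup>+t. ennreal c * (ennreal (endpoint_weight \<beta> t) * (indicator ?B y * indicator K x * W ((1 - t) *\<^sub>R y + t *\<^sub>R x))) \<partial>lborel \<partial>lborel \<partial>lborel)"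
    by (intro nn_integral_cong) (simp add: nn_integral_cmult[symmetric] mult_ac)
  also have "\<dots> = (\<integral>\<^sup>+y. \<integral>\<^sup>+t. \<integral>\<^sup>+x. ennreal c * (ennreal (endpoint_weight \<beta> t) * (indicator ?B y * indicator K x * W ((1 - t) *\<^sub>R y + t *\<^sub>R x))) \<partial>lborel \<partial>lborel \<partial>lborel)"
    by (intro nn_integral_cong lborel_pair.Fubini') measurable
  also have "\<dots> = (\<integral>\<^sup>+t. \<integral>\<^sup>+y. \<integral>\<^sup>+x. ennreal c * (ennreal (endpoint_weight \<beta> t) * (indicator ?B y * indicator K x * W ((1 - t) *\<^sub>R y + t *\<^sub>R x))) \<partial>lborel \<partial>lborel \<partial>lborel)"
    by (rule lborel_pair.Fubini') measurable
  also have "\<dots> = ennreal c * (\<integral>\<^sup>+t. ennreal (endpoint_weight \<beta> t) * (\<integral>\<^sup>+y. \<integral>\<^sup>+x. indicator ?B y * indicator K x * W ((1 - t) *\<^sub>R y + t *\<^sub>R x) \<partial>lborel \<partial>lborel) \<partial>lborel)"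
    by (simp add: nn_integral_cmult)
  also have "\<dots> \<le> ennreal c * (\<integral>\<^sup>+t. ennreal (endpoint_weight \<beta> t) * (4 * emeasure lborel K * (\<integral>\<^sup>+x. W x \<partial>lborel)) \<partial>lborel)"
  proof (rule mult_left_mono, rule nn_integral_mono)
    fix t :: real
    show "ennreal (endpoint_weight \<beta> t) * (\<integral>\<^sup>+y. \<integral>\<^sup>+x. indicator ?B y * indicator K x * W ((1 - t) *\<^sub>R y + t *\<^sub>R x) \<partial>lborel \<partial>lborel) \<le>
        ennreal (endpoint_weight \<beta> t) * (4 * emeasure lborel K * (\<integral>\<^sup>+x. W x \<partial>lborel))"
    proof (cases "t \<in> {0..1}")
      case True
      then show ?thesis
        by (intro mult_left_mono double_segment_integral_le emeasure_mono BK) auto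
    qed (simp add: endpoint_weight_def)
  qed auto
  also have "\<dots> = ennreal c * (ennreal (1 / (1 - \<beta>)) * (4 * emeasure lborel K * (\<integral>\<^sup>+x. W x \<partial>lborel)))"
    using \<beta> by (simp add: nn_integral_multc nn_integral_endpoint_weight)
  finally show ?thesis
    by (simp add: W_def c_def)
qed


text \<open>The double integral of \<open>|g x - g y|\<^sup>2\<close> is divided by the measure of the ball of radius \<open>r / 2\<close>. The
  set \<open>K\<close> lies in a ball of radius \<open>h\<close>, so the quotient of the two measures is at most \<open>4 h\<^sup>2 / r\<^sup>2\<close>;
  this and the factor 4 from the substitution make up the constant 16.\<close>

theorem weighted_poincare:
  fixes K :: "(real^2) set"
  assumes "open K" and sub: "ball z r \<subseteq> K" and star: "star_shaped_wrt K (ball z r)" and "0 \<notin> K"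
    and r: "r > 0" and diam: "\<And>x y. x \<in> K \<Longrightarrow> y \<in> K \<Longrightarrow> dist x y \<le> h"
    and \<beta>: "0 \<le> \<beta>" "\<beta> < 1"
    and wg: "weak_gradient K g g1 g2"
  obtains c where "(\<integral>\<^sup>+x. ennreal ((g x - c)\<^sup>2) \<partial>lebesgue_on K) \<le>
    ennreal (16 * h ^ 4 / r\<^sup>2 * (r / 2) powr (- 2 * \<beta>) / (1 - \<beta>)\<^sup>2) *
    (\<integral>\<^sup>+x. ennreal (norm x powr (2 * \<beta>) * ((g1 x)\<^sup>2 + (g2 x)\<^sup>2)) \<partial>lebesgue_on K)"
proof -
  obtain G G1 G2 where bv: "borel_version K g G" "borel_version K g1 G1" "borel_version K g2 G2"
    using locally_integrable_borel_version assms(1) wg unfolding weak_gradient_def by metis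
  have [measurable]: "K \<in> sets borel" "G \<in> borel_measurable borel"
      "G1 \<in> borel_measurable borel" "G2 \<in> borel_measurable borel"
    using assms(1) bv by (auto simp: borel_version_def)
  let ?B = "ball z (r / 2)"
  have [measurable]: "?B \<in> sets borel" by simp
  define C where "C = 16 * h ^ 4 / r\<^sup>2 * (r / 2) powr (- 2 * \<beta>) / (1 - \<beta>)\<^sup>2"
  have "C \<ge> 0"
    by (simp add: C_def)
  define IW where "IW = (\<integral>\<^sup>+x. ennreal (norm x powr (2 * \<beta>) * ((G1 x)\<^sup>2 + (G2 x)\<^sup>2)) \<partial>lborel)"
  define \<omega> where "\<omega> = unit_ball_vol 2"
  have \<omega>: "\<omega> > 0"
    by (simp add: \<omega>_def)
  have z: "z \<in> K"
    using sub r by auto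
  then have h: "h \<ge> 0"
    using diam[of z z] by simp
  have "K \<subseteq> cball z h"
    using diam z by auto
  then have "emeasure lborel K \<le> emeasure lborel (cball z h)"
    by (intro emeasure_mono) auto
  then have mK: "emeasure lborel K \<le> ennreal (\<omega> * h\<^sup>2)"
    using h by (simp add: emeasure_cball \<omega>_def)
  have mB: "emeasure lborel ?B = ennreal (\<omega> * (r / 2)\<^sup>2)"
    using r by (simp add: emeasure_ball \<omega>_def)
  define F where "F y = (\<integral>\<^sup>+x. indicator K x * ennreal ((G x - G y)\<^sup>2) \<partial>lborel)" for y
  have [measurable]: "F \<in> borel_measurable borel"
    unfolding F_def[abs_def] by measurable
  have "(\<integral>\<^sup>+y. indicator ?B y * F y \<partial>lborel) =
      (\<integral>\<^sup>+y. \<integral>\<^sup>+x. indicator ?B y * indicator K x * ennreal ((G x - G y)\<^sup>2) \<partial>lborel \<partial>lborel)"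
    unfolding F_def by (intro nn_integral_cong) (simp add: nn_integral_cmult[symmetric] mult.assoc)
  also have "\<dots> \<le> ennreal (h\<^sup>2 * (r / 2) powr (- 2 * \<beta>) / (1 - \<beta>)) * (ennreal (1 / (1 - \<beta>)) * (4 * emeasure lborel K * IW))"
    unfolding IW_def by (rule double_integral_of_differences[OF assms bv])
  also have "\<dots> \<le> ennreal (h\<^sup>2 * (r / 2) powr (- 2 * \<beta>) / (1 - \<beta>)) * (ennreal (1 / (1 - \<beta>)) * (4 * ennreal (\<omega> * h\<^sup>2) * IW))"
    by (intro mult_left_mono mult_right_mono mK) auto
  also have "\<dots> = ennreal (h\<^sup>2 * (r / 2) powr (- 2 * \<beta>) / (1 - \<beta>) * (1 / (1 - \<beta>)) * 4 * (\<omega> * h\<^sup>2)) * IW"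
  proof -
    have "ennreal a * (ennreal b * (4 * ennreal d * IW)) = ennreal (a * b * 4 * d) * IW"
      if "a \<ge> 0" "b \<ge> 0" "d \<ge> 0" for a b d
      using that by (simp add: ennreal_mult mult_ac)
    then show ?thesis
      using \<beta> \<omega> by simp
  qed
  also have "h\<^sup>2 * (r / 2) powr (- 2 * \<beta>) / (1 - \<beta>) * (1 / (1 - \<beta>)) * 4 * (\<omega> * h\<^sup>2) = C * (\<omega> * (r / 2)\<^sup>2)"
  proof -
    have "h\<^sup>2 * q / s * (1 / s) * 4 * (\<omega> * h\<^sup>2) = 16 * h ^ 4 / r\<^sup>2 * q / s\<^sup>2 * (\<omega> * (r / 2)\<^sup>2)"
      if "s \<noteq> 0" for q s :: real
      using r that by (simp add: field_simps power2_eq_square power4_eq_xxxx)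
    then show ?thesis
      using \<beta> unfolding C_def by simp
  qed
  also have "ennreal (C * (\<omega> * (r / 2)\<^sup>2)) * IW = (ennreal C * IW) * emeasure lborel ?B"
    using \<omega> \<open>C \<ge> 0\<close> by (simp add: mB ennreal_mult mult_ac)
  finally have le: "(\<integral>\<^sup>+y. indicator ?B y * F y \<partial>lborel) \<le> (ennreal C * IW) * emeasure lborel ?B" .
  have "emeasure lborel ?B \<noteq> 0" "emeasure lborel ?B \<noteq> \<infinity>"
    using \<omega> r by (auto simp: mB)
  from nn_integral_mean_value[OF _ _ this le] obtain y where y: "F y \<le> ennreal C * IW"
    by auto
  have "(\<integral>\<^sup>+x. ennreal ((g x - G y)\<^sup>2) \<partial>lebesgue_on K) = F y"
    unfolding F_def using bv(1) assms(1)
    by (intro borel_version_nn_integral) (auto simp: borel_version_def indicator_def elim!: eventually_mono)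
  moreover have "(\<integral>\<^sup>+x. ennreal (norm x powr (2 * \<beta>) * ((g1 x)\<^sup>2 + (g2 x)\<^sup>2)) \<partial>lebesgue_on K) = IW"
  proof -
    have "(\<integral>\<^sup>+x. ennreal (norm x powr (2 * \<beta>) * ((g1 x)\<^sup>2 + (g2 x)\<^sup>2)) \<partial>lebesgue_on K) =
        (\<integral>\<^sup>+x. indicator K x * ennreal (norm x powr (2 * \<beta>) * ((G1 x)\<^sup>2 + (G2 x)\<^sup>2)) \<partial>lborel)"
    proof (rule borel_version_nn_integral[OF assms(1)])
      have "AE x in lebesgue. indicator K x * g1 x = G1 x" "AE x in lebesgue. indicator K x * g2 x = G2 x"
        using bv by (auto simp: borel_version_def)
      then show "AE x in lebesgue. indicator K x * ennreal (norm x powr (2 * \<beta>) * ((g1 x)\<^sup>2 + (g2 x)\<^sup>2)) =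
          indicator K x * ennreal (norm x powr (2 * \<beta>) * ((G1 x)\<^sup>2 + (G2 x)\<^sup>2))"
        by eventually_elim (auto simp: indicator_def)
    qed measurable
    also have "\<dots> = IW"
      unfolding IW_def using bv by (intro nn_integral_cong) (auto simp: borel_version_def indicator_def)
    finally show ?thesis .
  qed
  ultimately show ?thesis
    using y that[of "G y"] by (simp add: C_def)
qed

lemma locally_integrable_mult_test:
  assumes "locally_integrable D g" "test_function D \<phi>" "open D"
  shows "integrable (lebesgue_on D) (\<lambda>x. g x * \<phi> x)"
proof -
  let ?S = "closure {x. \<phi> x \<noteq> 0}"
  have S: "compact ?S" "?S \<subseteq> D"
    using assms(2) by (auto simp: test_function_def)
  obtain B where B: "B \<ge> 0" "\<And>x. \<bar>\<phi> x\<bar> \<le> B"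
    using test_function_bounded[OF assms(2)] by metis
  have int: "integrable lebesgue (\<lambda>x. indicator ?S x * g x)"
    using assms(1) S by (auto simp: locally_integrable_def set_integrable_def)
  have \<phi>: "\<phi> \<in> borel_measurable lebesgue"
    using test_function_borel[OF assms(2)] by (intro measurable_completion) simp
  have "integrable lebesgue (\<lambda>x. indicator ?S x * g x * \<phi> x)"
    using int \<phi> B(2) by (rule integrable_mult_bounded)
  also have "(\<lambda>x. indicator ?S x * g x * \<phi> x) = (\<lambda>x. indicator D x *\<^sub>R (g x * \<phi> x))"
  proof (rule ext)
    fix x
    show "indicator ?S x * g x * \<phi> x = indicator D x *\<^sub>R (g x * \<phi> x)"
      using zero_off_closed_support[of x \<phi>] S by (cases "x \<in> ?S") auto
  qed
  finally show ?thesis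
    using assms(3) by (subst integrable_restrict_space) auto
qed

lemma locally_integrable_diff:
  "locally_integrable D f \<Longrightarrow> locally_integrable D g \<Longrightarrow> locally_integrable D (\<lambda>x. f x - g x)"
  by (auto simp: locally_integrable_def)

lemma locally_integrable_continuous:
  assumes "continuous_on UNIV f"
  shows "locally_integrable D f"
  unfolding locally_integrable_def
proof safe
  fix C :: "(real^2) set"
  assume "compact C"
  then have "integrable lborel (\<lambda>x. indicator C x *\<^sub>R f x)"
    using assms by (intro borel_integrable_compact) (auto intro: continuous_on_subset[OF assms])
  then show "f absolutely_integrable_on C"
    unfolding set_integrable_def by (subst integrable_completion) auto
qed

lemma has_weak_deriv_diff:
  assumes "has_weak_deriv D \<alpha> u g" "has_weak_deriv D \<alpha> v h" "open D"
  shows "has_weak_deriv D \<alpha> (\<lambda>x. u x - v x) (\<lambda>x. g x - h x)"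
  using assms unfolding has_weak_deriv_def
  by (auto simp: left_diff_distrib locally_integrable_diff locally_integrable_mult_test
      test_function_partials right_diff_distrib)

text \<open>The difference of the two candidates is orthogonal to all test functions. This makes any weak
  derivative a.e. equal to the one selected by \<open>weak_deriv\<close>.\<close>

lemma has_weak_deriv_unique:
  assumes "has_weak_deriv D \<alpha> u g" "has_weak_deriv D \<alpha> u h" "open D"
  shows "AE x in lebesgue_on D. g x = h x"
proof -
  have "AE x in lebesgue_on D. g x - h x = 0"
  proof (rule AE_eq_0_if_orthogonal_to_tests[OF assms(3)])
    show "locally_integrable D (\<lambda>x. g x - h x)"
      using assms by (auto simp: has_weak_deriv_def locally_integrable_diff)
    fix \<phi> assume \<phi>: "test_function D \<phi>"
    have "(LINT x|lebesgue_on D. (g x - h x) * \<phi> x) = (LINT x|lebesgue_on D. g x * \<phi> x) - (LINT x|lebesgue_on D. h x * \<phi> x)"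
      using assms \<phi> by (simp add: left_diff_distrib has_weak_deriv_def locally_integrable_mult_test)
    moreover have "(-1) ^ order_of \<alpha> * (LINT x|lebesgue_on D. g x * \<phi> x) = (-1) ^ order_of \<alpha> * (LINT x|lebesgue_on D. h x * \<phi> x)"
      using assms \<phi> by (simp add: has_weak_deriv_def)
    ultimately show "(LINT x|lebesgue_on D. (g x - h x) * \<phi> x) = 0"
      by simp
  qed
  then show ?thesis by simp
qed

lemma has_weak_deriv_weak_deriv: "has_weak_deriv D \<alpha> u g \<Longrightarrow> has_weak_deriv D \<alpha> u (weak_deriv D \<alpha> u)"
  unfolding weak_deriv_def by (rule someI[of "has_weak_deriv D \<alpha> u"])

lemma weak_deriv_eq_AE:
  assumes "has_weak_deriv D \<alpha> u g" "open D"
  shows "AE x in lebesgue_on D. weak_deriv D \<alpha> u x = g x"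
  using has_weak_deriv_unique[OF has_weak_deriv_weak_deriv[OF assms(1)] assms] .

lemma integral_lebesgue_on_superset:
  fixes f :: "real^2 \<Rightarrow> real"
  assumes "K \<subseteq> D" "open K" "open D" "\<And>x. x \<notin> K \<Longrightarrow> f x = 0"
  shows "(LINT x|lebesgue_on D. f x) = (LINT x|lebesgue_on K. f x)"
proof -
  have "f = (\<lambda>x. if x \<in> K then f x else 0)"
    using assms(4) by auto
  then show ?thesis
    using integral_restrict[OF assms(1), of f] assms(2,3) by simp
qed

lemma has_weak_deriv_subset:
  assumes "has_weak_deriv D \<alpha> u g" "K \<subseteq> D" "open K" "open D"
  shows "has_weak_deriv K \<alpha> u g"
  unfolding has_weak_deriv_def
proof (intro conjI allI impI)
  show "locally_integrable K u" "locally_integrable K g"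
    using assms(1,2) by (auto simp: has_weak_deriv_def locally_integrable_def)
  fix \<phi> assume \<phi>: "test_function K \<phi>"
  have "(LINT x|lebesgue_on K. u x * partials \<alpha> \<phi> x) = (LINT x|lebesgue_on D. u x * partials \<alpha> \<phi> x)"
    using test_function_outside[OF test_function_partials[OF \<phi>]] assms
    by (intro integral_lebesgue_on_superset[symmetric]) auto
  also have "\<dots> = (-1) ^ order_of \<alpha> * (LINT x|lebesgue_on D. g x * \<phi> x)"
    using assms(1) test_function_mono[OF \<phi> assms(2)] by (simp add: has_weak_deriv_def)
  also have "(LINT x|lebesgue_on D. g x * \<phi> x) = (LINT x|lebesgue_on K. g x * \<phi> x)"
    using test_function_outside[OF \<phi>] assms by (intro integral_lebesgue_on_superset) auto
  finally show "(LINT x|lebesgue_on K. u x * partials \<alpha> \<phi> x) = (-1) ^ order_of \<alpha> * (LINT x|lebesgue_on K. g x * \<phi> x)" .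
qed

text \<open>The definition of the first-order weak derivative is applied to a partial derivative of the
  test function, which is a test function again. For the first component of the gradient of
  \<open>g2\<close> this produces the mixed derivative in the opposite order.\<close>

lemma weak_gradient_of_weak_deriv:
  assumes "has_weak_deriv K (2, 0) u g11" "has_weak_deriv K (1, 1) u g12" "has_weak_deriv K (0, 2) u g22"
  shows "has_weak_deriv K (1, 0) u g1 \<Longrightarrow> weak_gradient K g1 g11 g12"
    and "has_weak_deriv K (0, 1) u g2 \<Longrightarrow> weak_gradient K g2 g12 g22"
  using assms test_function_partial_deriv[of K]
  unfolding weak_gradient_def has_weak_deriv_def partials_simps
  by (auto simp: order_of_def cutoff_algebra_partial_deriv_commute[of _ 1 2])

text \<open>The derivative of the product, which has compact support, integrates to zero.\<close>

lemma integral_by_parts_test: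
  assumes "smooth f" "test_function K \<phi>" "open K"
  shows "(LINT x|lebesgue_on K. f x * partial_deriv i \<phi> x) = - (LINT x|lebesgue_on K. partial_deriv i f x * \<phi> x)"
proof -
  have t: "test_function K (\<lambda>x. f x * \<phi> x)"
    using assms(1,2) by (rule test_function_mult)
  have t1: "test_function K (\<lambda>x. f x * partial_deriv i \<phi> x)" "test_function K (\<lambda>x. partial_deriv i f x * \<phi> x)"
    using assms by (auto intro!: test_function_mult test_function_partial_deriv smooth_partial_deriv)
  have lb: "(LINT x|lebesgue_on K. h x) = (LINT x|lborel. h x)" if "test_function K h" for h
  proof -
    have "(LINT x|lborel. h x) = (LINT x|lebesgue. h x)"
      using test_function_borel[OF that] by (intro integral_completion[symmetric]) simp
    also have "\<dots> = (LINT x|lebesgue_on K. h x)"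
      using integral_lebesgue_on_superset[of K UNIV h] test_function_outside[OF that] assms(3)
      by (simp add: lebesgue_on_UNIV_eq)
    finally show ?thesis ..
  qed
  have int: "integrable lborel h" if "test_function K h" for h
    using that by (intro compact_support_integrable) (auto simp: test_function_def smooth_continuous)
  have "0 = (LINT x|lborel. partial_deriv i (\<lambda>x. f x * \<phi> x) x)"
    using t by (intro integral_partial_deriv_eq_0[symmetric]) (auto simp: test_function_def)
  also have "\<dots> = (LINT x|lborel. f x * partial_deriv i \<phi> x + partial_deriv i f x * \<phi> x)"
    using assms by (subst partial_deriv_mult) (auto simp: smooth_differentiable test_function_def)
  also have "\<dots> = (LINT x|lborel. f x * partial_deriv i \<phi> x) + (LINT x|lborel. partial_deriv i f x * \<phi> x)"
    using t1[THEN int] by simp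
  finally show ?thesis
    by (simp add: lb t1)
qed


lemma orders:
  "{\<alpha>. order_of \<alpha> = 1} = {(1, 0), (0, 1)}"
  "{\<alpha>. order_of \<alpha> = 2} = {(2, 0), (1, 1), (0, 2)}"
  "{\<alpha>. order_of \<alpha> \<le> 1} = {(0, 0), (1, 0), (0, 1)}"
  by (auto simp: order_of_def)

lemma finite_orders: "finite {\<alpha>. order_of \<alpha> \<le> l}"
  by (rule finite_subset[of _ "{..l} \<times> {..l}"]) (auto simp: order_of_def)

lemma square_integrable_continuous:
  fixes f :: "'a::euclidean_space \<Rightarrow> real"
  assumes f: "continuous_on UNIV f" and S: "bounded S" "S \<in> sets lebesgue"
  shows "square_integrable S f"
proof -
  have "integrable lborel (\<lambda>x. indicator (closure S) x *\<^sub>R (f x)\<^sup>2)"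
    using S by (intro borel_integrable_compact continuous_intros continuous_on_subset[OF f]) auto
  then have "set_integrable lebesgue (closure S) (\<lambda>x. (f x)\<^sup>2)"
    unfolding set_integrable_def by (subst integrable_completion) auto
  then have "set_integrable lebesgue S (\<lambda>x. (f x)\<^sup>2)"
    by (rule set_integrable_subset) (use S closure_subset in auto)
  then have "integrable (lebesgue_on S) (\<lambda>x. (f x)\<^sup>2)"
    using S by (simp add: integrable_restrict_space set_integrable_def)
  moreover have "f \<in> borel_measurable (lebesgue_on S)"
    using f by (intro measurable_restrict_space1 measurable_completion) (simp add: borel_measurable_continuous_onI)
  ultimately show ?thesis
    by (simp add: square_integrable_def)
qed

lemma l2_norm_eq_0_if_AE: "AE x in lebesgue_on D. f x = 0 \<Longrightarrow> l2_norm D f = 0"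
  unfolding l2_norm_def by (subst integral_eq_zero_AE) auto

lemma sobolev_norm_zero:
  assumes "open D"
  shows "sobolev_norm l D (\<lambda>x. 0) = 0"
proof -
  have "has_weak_deriv D \<alpha> (\<lambda>x. 0) (\<lambda>x. 0)" for \<alpha>
    by (simp add: has_weak_deriv_def locally_integrable_continuous)
  then have "l2_norm D (weak_deriv D \<alpha> (\<lambda>x. 0)) = 0" for \<alpha>
    by (intro l2_norm_eq_0_if_AE weak_deriv_eq_AE assms)
  then show ?thesis
    by (simp add: sobolev_norm_def)
qed

section \<open>Linear functions in the virtual element space\<close>

definition linear_form :: "real \<Rightarrow> real \<Rightarrow> real^2 \<Rightarrow> real" where
  "linear_form a b x = a * x $ 1 + b * x $ 2"

lemma smooth_linear_form: "smooth (linear_form a b)"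
  unfolding linear_form_def[abs_def] by (intro cutoff_algebra_smooth cutoff_algebra.intros)

lemma partial_deriv_linear_form:
  "partial_deriv 1 (linear_form a b) = (\<lambda>x. a)" "partial_deriv 2 (linear_form a b) = (\<lambda>x. b)"
proof -
  have "(linear_form a b has_derivative linear_form a b) (at x)" for x
    unfolding linear_form_def[abs_def]
    by (intro has_derivative_add has_derivative_mult_right
        bounded_linear.has_derivative[OF bounded_linear_vec_nth has_derivative_ident])
  from partial_deriv_eqI[OF this] show "partial_deriv 1 (linear_form a b) = (\<lambda>x. a)" "partial_deriv 2 (linear_form a b) = (\<lambda>x. b)"
    by (simp_all add: linear_form_def axis_def)
qed

lemma has_weak_deriv_linear_form:
  assumes "open K"
  shows "has_weak_deriv K (0, 0) (linear_form a b) (linear_form a b)"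
    "has_weak_deriv K (1, 0) (linear_form a b) (\<lambda>x. a)"
    "has_weak_deriv K (0, 1) (linear_form a b) (\<lambda>x. b)"
  using integral_by_parts_test[OF smooth_linear_form[of a b] _ assms]
  unfolding has_weak_deriv_def partials_simps
  by (auto simp: order_of_def partial_deriv_linear_form
      locally_integrable_continuous smooth_continuous smooth_linear_form)

lemma linear_form_sobolev:
  assumes "open K" "bounded K"
  shows "linear_form a b \<in> sobolev_space 1 K"
proof -
  have s: "square_integrable K (linear_form a b)" "square_integrable K (\<lambda>x. a)" "square_integrable K (\<lambda>x. b)"
    using assms by (auto intro!: square_integrable_continuous smooth_continuous[OF smooth_linear_form])
  have "\<exists>g. has_weak_deriv K \<alpha> (linear_form a b) g \<and> square_integrable K g" if "order_of \<alpha> \<le> 1" for \<alpha>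
  proof -
    have "\<alpha> \<in> {(0, 0), (1, 0), (0, 1)}"
      using that orders(3) by blast
    then show ?thesis
      using s has_weak_deriv_linear_form[OF assms(1), of a b] by blast
  qed
  with s show ?thesis
    by (simp add: sobolev_space_def)
qed

lemma linear_form_polynomial:
  assumes "l \<ge> 1"
  shows "linear_form a b \<in> polynomials l"
proof -
  define c :: "multi_index \<Rightarrow> real" where "c \<alpha> = (if \<alpha> = (1, 0) then a else if \<alpha> = (0, 1) then b else 0)" for \<alpha>
  have "linear_form a b x = (\<Sum>\<alpha> | order_of \<alpha> \<le> l. c \<alpha> * (x $ 1) ^ fst \<alpha> * (x $ 2) ^ snd \<alpha>)" for x
  proof -
    have "(\<Sum>\<alpha> | order_of \<alpha> \<le> l. c \<alpha> * (x $ 1) ^ fst \<alpha> * (x $ 2) ^ snd \<alpha>) =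
        (\<Sum>\<alpha>\<in>{(1, 0), (0, 1)}. c \<alpha> * (x $ 1) ^ fst \<alpha> * (x $ 2) ^ snd \<alpha>)"
      using assms by (intro sum.mono_neutral_right finite_orders) (auto simp: c_def order_of_def)
    also have "\<dots> = linear_form a b x"
      by (simp add: c_def linear_form_def)
    finally show ?thesis ..
  qed
  then show ?thesis
    unfolding polynomials_def by blast
qed

lemma zero_polynomial: "(\<lambda>x. 0) \<in> polynomials l"
  unfolding polynomials_def by (rule CollectI, rule exI[of _ "\<lambda>_. 0"]) simp

text \<open>The trace is witnessed by the constant sequence, as linear functions are smooth; the Laplacian
  vanishes because the integral of a derivative of a test function does.\<close>

lemma linear_form_virtual_space:
  assumes "finite T" "K \<in> T" "p K \<ge> 1" "open (region K)" "bounded (region K)"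
  shows "linear_form a b \<in> virtual_space T p K"
proof -
  let ?l = "linear_form a b"
  have c: "continuous_on S ?l" for S
    by (intro smooth_continuous smooth_linear_form)
  have lap: "has_weak_laplacian (region K) ?l (\<lambda>x. 0)"
    unfolding has_weak_laplacian_def
  proof (intro conjI allI impI)
    fix \<phi> assume \<phi>: "test_function (region K) \<phi>"
    note d = test_function_partial_deriv[OF \<phi>]
    have 0: "(LINT x|lebesgue_on (region K). r * partial_deriv i \<phi> x) = 0" for r i
      using integral_by_parts_test[OF cutoff_algebra_smooth[OF cutoff_algebra.const] \<phi> assms(4), of r i]
      by (simp add: partial_deriv_const)
    have "(LINT x|lebesgue_on (region K). ?l x * (partials (2, 0) \<phi> x + partials (0, 2) \<phi> x)) =
        (LINT x|lebesgue_on (region K). ?l x * partial_deriv 1 (partial_deriv 1 \<phi>) x) +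
        (LINT x|lebesgue_on (region K). ?l x * partial_deriv 2 (partial_deriv 2 \<phi>) x)"
      unfolding partials_simps distrib_left
      by (intro Bochner_Integration.integral_add locally_integrable_mult_test locally_integrable_continuous c
          test_function_partial_deriv \<phi> assms)
    also have "\<dots> = 0"
      unfolding integral_by_parts_test[OF smooth_linear_form d assms(4)] partial_deriv_linear_form 0 by simp
    finally show "(LINT x|lebesgue_on (region K). ?l x * (partials (2, 0) \<phi> x + partials (0, 2) \<phi> x)) =
        (LINT x|lebesgue_on (region K). 0 * \<phi> x)"
      by simp
  qed (auto intro: locally_integrable_continuous c)
  have "square_integrable {0..1} (\<lambda>t. ?l (linepath x y t))" for x y
    by (intro square_integrable_continuous continuous_on_compose2[OF c[of UNIV]])
       (auto simp: linepath_def intro!: continuous_intros)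
  then have trace: "has_trace K ?l ?l"
    unfolding has_trace_def
    by (auto intro!: exI[of _ "\<lambda>_. ?l"] simp: smooth_linear_form sobolev_norm_zero[OF assms(4)] l2_norm_eq_0_if_AE)
  \<comment> \<open>The maximum that defines the degree of an edge is over a finite set that contains the degree of \<open>K\<close>.\<close>
  have "edge_degree T p E \<ge> 1" if "E \<in> edges K" for E
  proof -
    have "p K \<le> Max (p ` {K \<in> T. E \<in> edges K})"
      using assms(1,2) that by (intro Max_ge) auto
    with assms(3) show ?thesis
      by (simp add: edge_degree_def)
  qed
  then have poly: "\<forall>E\<in>edges K. \<exists>q\<in>polynomials (edge_degree T p E). \<forall>x\<in>E. ?l x = q x"
    using linear_form_polynomial by blast
  show ?thesis
    using linear_form_sobolev[OF assms(4,5)] lap zero_polynomial trace c poly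
    unfolding virtual_space_def by blast
qed


section \<open>Approximation by linear functions near the singular vertex\<close>

lemma pathstart_polypath: "vs \<noteq> [] \<Longrightarrow> pathstart (polypath vs) = hd vs"
  by (induction vs rule: polypath.induct) auto

lemma vertices_on_polypath: "set vs \<subseteq> path_image (polypath vs)"
proof (induction vs rule: polypath.induct)
  case (4 v w x vs)
  then show ?case
    by (subst polypath.simps, subst path_image_join) (auto simp: pathstart_polypath)
qed auto

lemma
  assumes "is_polygon K"
  shows open_region: "open (region K)" and bounded_region: "bounded (region K)"
    and vertex_not_in_region: "v \<in> set K \<Longrightarrow> v \<notin> region K"
proof -
  have path: "path (boundary_path K)"
    using assms by (simp add: is_polygon_def simple_path_imp_path)
  show "open (region K)"
    unfolding region_def by (intro open_inside closed_path_image path)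
  show "bounded (region K)"
    unfolding region_def by (intro bounded_inside bounded_path_image path)
  assume "v \<in> set K"
  then have "v \<in> path_image (boundary_path K)"
    using vertices_on_polypath[of "K @ [hd K]"] by (auto simp: boundary_path_def)
  then show "v \<notin> region K"
    unfolding region_def using inside_no_overlap by blast
qed

lemma sobolev_seminorm_1_squared:
  "(sobolev_seminorm 1 D u)\<^sup>2 = (LINT x|lebesgue_on D. (weak_deriv D (1, 0) u x)\<^sup>2) + (LINT x|lebesgue_on D. (weak_deriv D (0, 1) u x)\<^sup>2)"
  unfolding sobolev_seminorm_def orders(1) by (simp add: l2_norm_def)

text \<open>The weighted Poincare inequality is applied to the two first derivatives of \<open>u\<close>, whose gradients
  are both bounded by \<open>|D\<^sup>2u|\<close>; hence the constant is twice the one there. The integral on the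
  right-hand side would be zero if the function were not integrable, so the integrability on \<open>\<Omega>\<close> is
  transferred to \<open>K\<close> first. The selected weak derivatives on \<open>K\<close> and on \<open>\<Omega>\<close> agree almost everywhere by uniqueness.\<close>

lemma exists_linear_approximation:
  fixes K \<Omega> :: "(real^2) set"
  assumes op: "open K" "open \<Omega>" "K \<subseteq> \<Omega>" and bd: "bounded K"
    and sub: "ball z r \<subseteq> K" and star: "star_shaped_wrt K (ball z r)" and "0 \<notin> K"
    and r: "r > 0" and \<beta>: "0 \<le> \<beta>" "\<beta> < 1"
    and u: "u \<in> weighted_space \<beta> 2 2 \<Omega>"
  obtains a b where "(sobolev_seminorm 1 K (\<lambda>x. u x - linear_form a b x))\<^sup>2 \<le>
    32 * diameter K ^ 4 / r\<^sup>2 * (r / 2) powr (- 2 * \<beta>) / (1 - \<beta>)\<^sup>2 *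
    (l2_norm K (\<lambda>x. norm x powr \<beta> * abs_deriv K 2 u x))\<^sup>2"
proof -
  define d where "d \<alpha> = weak_deriv K \<alpha> u" for \<alpha>
  have ex: "\<exists>g. has_weak_deriv \<Omega> \<alpha> u g" if "order_of \<alpha> \<le> 2" for \<alpha>
    using u that unfolding weighted_space_def by blast
  have wd\<Omega>: "has_weak_deriv \<Omega> \<alpha> u (weak_deriv \<Omega> \<alpha> u)" if "order_of \<alpha> \<le> 2" for \<alpha>
    using ex[OF that] has_weak_deriv_weak_deriv by blast
  then have wdK': "has_weak_deriv K \<alpha> u (weak_deriv \<Omega> \<alpha> u)" if "order_of \<alpha> \<le> 2" for \<alpha>
    using that op by (blast intro: has_weak_deriv_subset)
  have wdK: "has_weak_deriv K \<alpha> u (d \<alpha>)" if "order_of \<alpha> \<le> 2" for \<alpha>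
    unfolding d_def using wdK'[OF that] by (rule has_weak_deriv_weak_deriv)
  have wg: "weak_gradient K (d (1, 0)) (d (2, 0)) (d (1, 1))" "weak_gradient K (d (0, 1)) (d (1, 1)) (d (0, 2))"
    using weak_gradient_of_weak_deriv[OF wdK wdK wdK, OF _ _ _ wdK] by (simp_all add: order_of_def)
  define Q where "Q x = (norm x powr \<beta> * abs_deriv K 2 u x)\<^sup>2" for x
  have Q: "Q x = norm x powr (2 * \<beta>) * ((d (2, 0) x)\<^sup>2 + (d (1, 1) x)\<^sup>2 + (d (0, 2) x)\<^sup>2)" for x
    by (simp add: Q_def power_mult_distrib powr_square abs_deriv_def orders d_def add.assoc)
  have intQ: "integrable (lebesgue_on K) Q"
  proof -
    let ?Q = "\<lambda>x. (weighted_deriv \<Omega> (\<beta> + real (2 - 2)) 2 u x)\<^sup>2"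
    have "integrable (lebesgue_on \<Omega>) ?Q"
      using u by (auto simp: weighted_space_def square_integrable_def)
    then have "set_integrable lebesgue \<Omega> ?Q"
      using op by (simp add: integrable_restrict_space set_integrable_def)
    then have "set_integrable lebesgue K ?Q"
      by (rule set_integrable_subset) (use op in auto)
    then have int: "integrable (lebesgue_on K) ?Q"
      using op by (simp add: integrable_restrict_space set_integrable_def)
    have "AE x in lebesgue_on K. d \<alpha> x = weak_deriv \<Omega> \<alpha> u x" if "order_of \<alpha> = 2" for \<alpha>
      using that by (intro has_weak_deriv_unique[OF wdK wdK' op(1)]) auto
    then have "AE x in lebesgue_on K. d (2, 0) x = weak_deriv \<Omega> (2, 0) u x"
      "AE x in lebesgue_on K. d (1, 1) x = weak_deriv \<Omega> (1, 1) u x"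
      "AE x in lebesgue_on K. d (0, 2) x = weak_deriv \<Omega> (0, 2) u x"
      by (simp_all add: order_of_def)
    then have ae: "AE x in lebesgue_on K. ?Q x = Q x"
      by eventually_elim
         (simp add: Q weighted_deriv_def abs_deriv_def orders power_mult_distrib powr_square add.assoc mult.commute)
    have meas: "d \<alpha> \<in> borel_measurable (lebesgue_on K)" if "order_of \<alpha> \<le> 2" for \<alpha>
      using wdK[OF that] op(1) by (intro locally_integrable_measurable) (auto simp: has_weak_deriv_def)
    have "(\<lambda>x. norm x powr (2 * \<beta>)) \<in> borel_measurable (lebesgue_on K)"
      by (intro measurable_restrict_space1 measurable_completion) simp
    then have "Q \<in> borel_measurable (lebesgue_on K)"
      unfolding Q[abs_def] by (intro borel_measurable_times borel_measurable_add borel_measurable_power meas)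
        (auto simp: order_of_def)
    with int ae show ?thesis
      using integrable_cong_AE_imp by blast
  qed
  define C where "C = 16 * diameter K ^ 4 / r\<^sup>2 * (r / 2) powr (- 2 * \<beta>) / (1 - \<beta>)\<^sup>2"
  define I where "I = (LINT x|lebesgue_on K. Q x)"
  have I: "I \<ge> 0" and C: "C \<ge> 0"
    using diameter_ge_0[OF bd] by (auto simp: I_def C_def Q_def)
  have nnQ: "(\<integral>\<^sup>+x. ennreal (Q x) \<partial>lebesgue_on K) = ennreal I"
    unfolding I_def by (intro nn_integral_eq_integral intQ AE_I2) (simp add: Q_def)
  have diam: "dist x y \<le> diameter K" if "x \<in> K" "y \<in> K" for x y
    using diameter_bounded_bound[OF bd that] .
  have approx: "\<exists>c. (LINT x|lebesgue_on K. (g x - c)\<^sup>2) \<le> C * I"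
    if g: "weak_gradient K g g1 g2" and le: "\<And>x. norm x powr (2 * \<beta>) * ((g1 x)\<^sup>2 + (g2 x)\<^sup>2) \<le> Q x" for g g1 g2
  proof -
    obtain c where "(\<integral>\<^sup>+x. ennreal ((g x - c)\<^sup>2) \<partial>lebesgue_on K) \<le>
        ennreal C * (\<integral>\<^sup>+x. ennreal (norm x powr (2 * \<beta>) * ((g1 x)\<^sup>2 + (g2 x)\<^sup>2)) \<partial>lebesgue_on K)"
      using weighted_poincare[OF op(1) sub star \<open>0 \<notin> K\<close> r diam \<beta> g] unfolding C_def by metis
    also have "\<dots> \<le> ennreal C * (\<integral>\<^sup>+x. ennreal (Q x) \<partial>lebesgue_on K)"
      by (intro mult_left_mono nn_integral_mono ennreal_leI le) simp
    also have "\<dots> = ennreal (C * I)"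
      using C I by (simp add: nnQ ennreal_mult)
    finally have "(LINT x|lebesgue_on K. (g x - c)\<^sup>2) \<le> C * I"
      using C I by (intro integral_real_bounded) auto
    then show ?thesis ..
  qed
  have "\<exists>a. (LINT x|lebesgue_on K. (d (1, 0) x - a)\<^sup>2) \<le> C * I"
    by (rule approx[OF wg(1)]) (auto simp: Q intro!: mult_left_mono)
  then obtain a where a: "(LINT x|lebesgue_on K. (d (1, 0) x - a)\<^sup>2) \<le> C * I" ..
  have "\<exists>b. (LINT x|lebesgue_on K. (d (0, 1) x - b)\<^sup>2) \<le> C * I"
    by (rule approx[OF wg(2)]) (auto simp: Q intro!: mult_left_mono)
  then obtain b where b: "(LINT x|lebesgue_on K. (d (0, 1) x - b)\<^sup>2) \<le> C * I" ..
  have eq: "(LINT x|lebesgue_on K. (weak_deriv K \<alpha> (\<lambda>x. u x - linear_form a b x) x)\<^sup>2) = (LINT x|lebesgue_on K. (d \<alpha> x - c)\<^sup>2)"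
    if "order_of \<alpha> \<le> 2" "has_weak_deriv K \<alpha> (linear_form a b) (\<lambda>x. c)" for \<alpha> c
  proof -
    have wd: "has_weak_deriv K \<alpha> (\<lambda>x. u x - linear_form a b x) (\<lambda>x. d \<alpha> x - c)"
      by (intro has_weak_deriv_diff wdK that op)
    have "weak_deriv K \<alpha> (\<lambda>x. u x - linear_form a b x) \<in> borel_measurable (lebesgue_on K)"
      "(\<lambda>x. d \<alpha> x - c) \<in> borel_measurable (lebesgue_on K)"
      using wd has_weak_deriv_weak_deriv[OF wd] op(1)
      by (auto simp: has_weak_deriv_def intro!: locally_integrable_measurable)
    moreover have "AE x in lebesgue_on K. weak_deriv K \<alpha> (\<lambda>x. u x - linear_form a b x) x = d \<alpha> x - c"
      using wd op(1) by (rule weak_deriv_eq_AE)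
    ultimately show ?thesis
      by (intro integral_cong_AE borel_measurable_power) (auto elim: eventually_mono)
  qed
  have "(sobolev_seminorm 1 K (\<lambda>x. u x - linear_form a b x))\<^sup>2 \<le> C * I + C * I"
    unfolding sobolev_seminorm_1_squared
    using a b eq[OF _ has_weak_deriv_linear_form(2)[OF op(1)]] eq[OF _ has_weak_deriv_linear_form(3)[OF op(1)]]
    by (simp add: order_of_def)
  also have "\<dots> = 32 * diameter K ^ 4 / r\<^sup>2 * (r / 2) powr (- 2 * \<beta>) / (1 - \<beta>)\<^sup>2 * I"
    by (simp add: C_def)
  also have "I = (l2_norm K (\<lambda>x. norm x powr \<beta> * abs_deriv K 2 u x))\<^sup>2"
    using I by (simp add: l2_norm_def I_def Q_def)
  finally show ?thesis
    by (rule that)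
qed


text \<open>The powers of \<open>h\<close> add up to \<open>h\<^sup>2\<^sup>-\<^sup>2\<^sup>\<beta>\<close>, to which the bound on the diameter is applied.\<close>

lemma power_bound_of_diameter:
  fixes c1 \<sigma> \<beta> \<gamma> h :: real
  assumes "0 < \<sigma>" "0 < c1" "0 < \<gamma>" "0 < h" and h: "c1 * h \<le> \<sigma> ^ n" and \<beta>: "\<beta> < 1"
  shows "32 * h ^ 4 / (\<gamma> * h)\<^sup>2 * (\<gamma> * h / 2) powr (- 2 * \<beta>) / (1 - \<beta>)\<^sup>2 \<le>
    32 / \<gamma>\<^sup>2 * (\<gamma> / 2) powr (- 2 * \<beta>) / (1 - \<beta>)\<^sup>2 * c1 powr (- (2 * (1 - \<beta>))) * \<sigma> powr (2 * (1 - \<beta>) * real n)"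
proof -
  have b: "(\<gamma> * h / 2) powr (- 2 * \<beta>) = (\<gamma> / 2) powr (- 2 * \<beta>) * h powr (- 2 * \<beta>)"
    using assms by (subst powr_mult[symmetric]) auto
  have a: "h ^ 4 / (\<gamma> * h)\<^sup>2 = h powr 2 / \<gamma>\<^sup>2"
    using assms by (simp add: field_simps power2_eq_square power4_eq_xxxx)
  have c: "h powr 2 * h powr (- 2 * \<beta>) = h powr (2 * (1 - \<beta>))"
    by (simp add: powr_add[symmetric] algebra_simps)
  have "32 * h ^ 4 / (\<gamma> * h)\<^sup>2 * (\<gamma> * h / 2) powr (- 2 * \<beta>) / (1 - \<beta>)\<^sup>2 =
      32 / \<gamma>\<^sup>2 * (\<gamma> / 2) powr (- 2 * \<beta>) / (1 - \<beta>)\<^sup>2 * h powr (2 * (1 - \<beta>))"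
  proof -
    have "32 * x / y * q / s = 32 / g * w / s * v" if "x / y = m / g" "q = w * k" "m * k = v"
      for x y q s g w v m k :: real
    proof -
      have "32 * x / y * q / s = 32 * (x / y) * q / s"
        by simp
      also have "\<dots> = 32 / g * w / s * (m * k)"
        unfolding that(1,2) by simp
      finally show ?thesis
        by (simp add: that(3))
    qed
    then show ?thesis
      using a b c by blast
  qed
  moreover have "h powr (2 * (1 - \<beta>)) \<le> c1 powr (- (2 * (1 - \<beta>))) * \<sigma> powr (2 * (1 - \<beta>) * real n)"
  proof -
    have "h \<le> \<sigma> ^ n / c1"
      using assms by (simp add: field_simps)
    then have "h powr (2 * (1 - \<beta>)) \<le> (\<sigma> ^ n / c1) powr (2 * (1 - \<beta>))"
      using assms by (intro powr_mono2) auto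
    also have "\<dots> = (\<sigma> powr real n) powr (2 * (1 - \<beta>)) / c1 powr (2 * (1 - \<beta>))"
      using assms by (simp add: powr_divide powr_realpow)
    also have "\<dots> = c1 powr (- (2 * (1 - \<beta>))) * \<sigma> powr (2 * (1 - \<beta>) * real n)"
    proof -
      have "(\<sigma> powr real n) powr e / c1 powr e = c1 powr (- e) * \<sigma> powr (e * real n)" for e
        by (simp add: powr_powr powr_minus divide_inverse mult.commute)
      then show ?thesis .
    qed
    finally show ?thesis .
  qed
  then have "32 / \<gamma>\<^sup>2 * (\<gamma> / 2) powr (- 2 * \<beta>) / (1 - \<beta>)\<^sup>2 * h powr (2 * (1 - \<beta>)) \<le>
      32 / \<gamma>\<^sup>2 * (\<gamma> / 2) powr (- 2 * \<beta>) / (1 - \<beta>)\<^sup>2 * (c1 powr (- (2 * (1 - \<beta>))) * \<sigma> powr (2 * (1 - \<beta>) * real n))"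
    by (rule mult_left_mono) simp
  ultimately show ?thesis
    by (simp only: mult.assoc)
qed

theorem lemma5p6:
  fixes P :: polygon and \<Omega> :: "(real^2) set"
    and \<sigma> \<beta> \<gamma> \<gamma>' c1 c2 \<kappa> :: real and N :: nat
  assumes "is_polygon P" and "\<Omega> = region P" and "0 \<in> set P"
    and "0 < \<sigma>" and "\<sigma> < 1"
    and "0 < \<beta>" and "\<beta> < 1"
    and "0 < \<gamma>" and "0 < \<gamma>'" and "0 < c1" and "0 < c2" and "0 < \<kappa>"
  shows "\<exists>C>0. \<forall>(T :: nat \<Rightarrow> polygon set) (p :: nat \<Rightarrow> polygon \<Rightarrow> nat).
    layered_meshes P T \<and> D1 \<gamma> T \<and> D2 \<gamma>' N T \<and> D3 \<sigma> c1 c2 N T p \<and> D4 c1 c2 N \<kappa> \<Omega> T \<and>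
    (\<forall>n. \<forall>K'\<in>layer (T n) 0. p n K' = 2) \<and>
    (\<forall>n. \<forall>K'\<in>layer (T n) 1. equiv_up_to c1 c2 (real (p n K')) 2) \<longrightarrow>
    (\<forall>n. \<forall>K\<in>layer (T n) 0. \<forall>f u.
       f \<in> analytic_weighted_space \<beta> 0 \<Omega> \<and> weak_solution \<Omega> f u \<and>
       u \<in> analytic_weighted_space \<beta> 2 \<Omega> \<longrightarrow>
       (\<exists>u\<^sub>I \<in> virtual_space (T n) (p n) K.
          (sobolev_seminorm 1 (region K) (\<lambda>x. u x - u\<^sub>I x))\<^sup>2 \<le>
          C * (\<sigma> powr (2 * (1 - \<beta>) * real n) *
                 (l2_norm (region K) (\<lambda>x. norm x powr \<beta> * abs_deriv (region K) 2 u x))\<^sup>2 +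
               (l2_norm (region K)
                  (\<lambda>x. f x - l2_projection (region K) (p n K - 2) f x))\<^sup>2)))"
proof -
  define C where "C = 32 / \<gamma>\<^sup>2 * (\<gamma> / 2) powr (- 2 * \<beta>) / (1 - \<beta>)\<^sup>2 * c1 powr (- (2 * (1 - \<beta>)))"
  have "C > 0"
    using assms by (simp add: C_def)
  have bound: "\<exists>u\<^sub>I \<in> virtual_space (T n) (p n) K.
          (sobolev_seminorm 1 (region K) (\<lambda>x. u x - u\<^sub>I x))\<^sup>2 \<le>
          C * (\<sigma> powr (2 * (1 - \<beta>) * real n) *
                 (l2_norm (region K) (\<lambda>x. norm x powr \<beta> * abs_deriv (region K) 2 u x))\<^sup>2 + (l2_norm (region K) e)\<^sup>2)"
    if mesh: "layered_meshes P T" and d1: "D1 \<gamma> T" and d3: "D3 \<sigma> c1 c2 N T p"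
      and p: "\<forall>n. \<forall>K'\<in>layer (T n) 0. p n K' = 2"
      and K: "K \<in> layer (T n) 0" and u: "u \<in> analytic_weighted_space \<beta> 2 \<Omega>"
    for T p n K e and u :: "real^2 \<Rightarrow> real"
  proof -
    have KT: "K \<in> T n" and "0 \<in> set K"
      using K by auto
    have conf: "conforming_decomposition \<Omega> (T n)"
      using mesh assms(2) by (simp add: layered_meshes_def)
    then have poly: "is_polygon K" and sub: "region K \<subseteq> \<Omega>" and "finite (T n)"
      using KT by (auto simp: conforming_decomposition_def)
    have op: "open (region K)" "open \<Omega>" and bd: "bounded (region K)" and "0 \<notin> region K"
      using open_region bounded_region vertex_not_in_region poly assms(1,2) \<open>0 \<in> set K\<close> by blast+
    define h where "h = diameter (region K)"
    have h: "c1 * h \<le> \<sigma> ^ n" "\<sigma> ^ n \<le> c2 * h"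
      using d3 K by (auto simp: D3_def equiv_up_to_def h_def)
    have "0 < \<sigma> ^ n"
      using assms by simp
    with h(2) have "h > 0"
      using assms by (metis less_le_trans zero_less_mult_pos)
    obtain z r where r: "r \<ge> \<gamma> * h" and ball: "ball z r \<subseteq> region K" and star: "star_shaped_wrt (region K) (ball z r)"
      using d1 KT unfolding D1_def h_def by blast
    \<comment> \<open>The constant must not depend on \<open>K\<close>, so the ball is shrunk to a radius that is a fixed multiple of \<open>h\<close>.\<close>
    have smaller: "ball z (\<gamma> * h) \<subseteq> ball z r"
      using r by (rule subset_ball)
    have star': "star_shaped_wrt (region K) (ball z (\<gamma> * h))"
      using star smaller unfolding star_shaped_wrt_def by blast
    have "u \<in> weighted_space \<beta> 2 2 \<Omega>"
      using u by (simp add: analytic_weighted_space_def)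
    then obtain a b where ab: "(sobolev_seminorm 1 (region K) (\<lambda>x. u x - linear_form a b x))\<^sup>2 \<le>
        32 * h ^ 4 / (\<gamma> * h)\<^sup>2 * (\<gamma> * h / 2) powr (- 2 * \<beta>) / (1 - \<beta>)\<^sup>2 *
        (l2_norm (region K) (\<lambda>x. norm x powr \<beta> * abs_deriv (region K) 2 u x))\<^sup>2" (is "_ \<le> _ * ?D")
      using exists_linear_approximation[OF op sub bd order_trans[OF smaller ball] star' \<open>0 \<notin> region K\<close>, of \<beta> u]
        assms \<open>h > 0\<close> unfolding h_def by auto
    also have "\<dots> \<le> C * \<sigma> powr (2 * (1 - \<beta>) * real n) * ?D"
      using power_bound_of_diameter[OF \<open>0 < \<sigma>\<close> \<open>0 < c1\<close> \<open>0 < \<gamma>\<close> \<open>h > 0\<close> h(1) \<open>\<beta> < 1\<close>]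
      unfolding C_def by (rule mult_right_mono) simp
    also have "\<dots> \<le> C * (\<sigma> powr (2 * (1 - \<beta>) * real n) * ?D + (l2_norm (region K) e)\<^sup>2)"
      using \<open>C > 0\<close> by (simp add: distrib_left mult.assoc)
    finally have "(sobolev_seminorm 1 (region K) (\<lambda>x. u x - linear_form a b x))\<^sup>2 \<le> \<dots>" .
    moreover have "linear_form a b \<in> virtual_space (T n) (p n) K"
      using p K by (intro linear_form_virtual_space \<open>finite (T n)\<close> KT op bd) auto
    ultimately show ?thesis
      by blast
  qed
  show ?thesis
    by (intro exI[of _ C] conjI \<open>C > 0\<close> allI impI ballI, elim conjE) (rule bound)
qed

end
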